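(* Let $1\le k\le n$ be integers, let $b=\lceil n/k\rceil$ and $1\le t\le n$. The errors $\mathcal{E}_t(\mathbf{B},\mathbf{C})$ under $b$-min-separation with at most $k$ participations, for the factorizations $\mathbf{A}=\mathbf{B}\mathbf{C}$ with $\mathbf{B}=\mathbf{A}\mathbf{C}^{-1}$ and the following choices of $\mathbf{C}$, satisfy (with absolute implied constants): Non-banded: 1. for $\mathbf{C}=\mathbf{E}_1^{1/2}$: $\mathcal{E}_t(\mathbf{B},\mathbf{C})=\Theta\left(\sqrt{\frac{k(\ln n+k)}{t}}\right)$; 2. for $\mathbf{C}=\mathbf{I}$ and $t\ge 2$: $\mathcal{E}_t(\mathbf{B},\mathbf{C})=\Theta\left(\sqrt{\frac{k\ln t}{t}}\right)$; 3. for $\mathbf{C}=\mathbf{D}_{\mathrm{Toep}}$: $\mathcal{E}_t(\mathbf{B},\mathbf{C})=O\left(\sqrt{\frac{k}{t}}+\frac{k}{\sqrt{nt}}\sqrt{\ln k\,\ln n}\right)$. Banded inverse: 4. for the $p$-banded-inverse version $\mathbf{C}=(\mathbf{E}_1^{1/2})^{p}$ with $p=\lceil\log_2 b\rceil$ and $n/k>e$: $\mathcal{E}_t(\mathbf{B},\mathbf{C})=O\left(\sqrt{\frac{k\,\ln (n)\,\ln\ln(n/k)}{t\,\ln(n/k)}}+\frac{k}{\sqrt{nt}}\sqrt{\ln n}\right)$; 5. for the $p$-banded-inverse version of $\mathbf{I}$ with $p=b$ (which is again $\mathbf{I}$) and $t\ge2$: $\mathcal{E}_t(\mathbf{B},\mathbf{C})=\Theta\left(\sqrt{\frac{k\ln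 t}{t}}\right)$; 6. for the $p$-banded-inverse version $\mathbf{C}=\mathbf{D}_{\mathrm{Toep}}^{p}$ with $p=b$ and $n>k$: $\mathcal{E}_t(\mathbf{B},\mathbf{C})=O\left(\sqrt{\frac{k}{t}}+\sqrt{\frac{k\ln k}{t\,\ln^2(n/k)}}\right)$.
   Context: All matrices are real $n\times n$. $\mathbf{A}$ is the running-average matrix: $\mathbf{A}_{i,j}=1/i$ for $j\le i$ and $0$ for $j>i$. $\mathbf{E}_1$ is the prefix-sum matrix (entries $1$ for $j\le i$, $0$ for $j>i$), and $\mathbf{E}_1^{1/2}$ is its lower-triangular Toeplitz square root, with entries $r_{i-j}$ for $j\le i$, where $r_m=\left|\binom{-1/2}{m}\right|$. $\mathbf{D}_{\mathrm{Toep}}$ is the lower-triangular Toeplitz matrix with entries $\frac{1}{i-j+1}$ for $j\le i$, $0$ otherwise. Banded inverse: for an invertible lower-triangular Toeplitz $\mathbf{C}$ and integer $p\ge1$, $\mathbf{C}^{p}$ (a notation, not a matrix power) is the matrix whose inverse is obtained from $\mathbf{C}^{-1}$ by keeping the entries with $0\le i-j<p$ and setting all other entries to zero. Sensitivity: $\Pi_{k,b}$ is the family of subsets $\pi\subseteq\{1,\dots,n\}$ with $|\pi|\le k$ such that any two distinct $i,j\in\pi$ satisfy $|i-j|\ge b$. For a fixed dimension $d\ge1$, $$\mathrm{sens}_{k,b}(\mathbf{C})=\max_{\pi\in\Pi_{k,b}}\ \max_{(x_i)_{i\in\pi},\ x_i\in\mathbb{R}^d,\ \|x_i\|_2\le1}\Big\|\sum_{i\in\pi}\mathbf{C}_{:,i}\,x_i^\top\Big\|_F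 ,$$ where $\mathbf{C}_{:,i}$ is the $i$-th column. Error at step $t$: $\mathcal{E}_t(\mathbf{B},\mathbf{C})=\frac{1}{\sqrt t}\|\mathbf{B}_{:t}\|_F\cdot\mathrm{sens}_{k,b}(\mathbf{C})$, where $\mathbf{B}_{:t}$ consists of the first $t$ rows of $\mathbf{B}$. *)

theory Defs
  imports
    "Jordan_Normal_Form.Determinant"
    "Jordan_Normal_Form.Gauss_Jordan_Elimination"
    "HOL-Analysis.L2_Norm"
    "HOL-Library.Landau_Symbols"
    "HOL-Computational_Algebra.Formal_Power_Series"
begin

text \<open>
  Matrices and vectors are those of Jordan_Normal_Form, hence indexed from 0: row \<open>i\<close> and
  column \<open>j\<close> here are row \<open>i + 1\<close> and column \<open>j + 1\<close> when counting from 1. The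
  shift changes the formula for \<open>averaging\<close>, but not those for the Toeplitz matrices or for the
  participation patterns, which only involve differences of indices.
\<close>

section \<open>Matrices\<close>

definition averaging :: "nat \<Rightarrow> real mat" where
  "averaging n = mat n n (\<lambda>(i, j). if j \<le> i then 1 / real (i + 1) else 0)"

definition lower_toeplitz :: "nat \<Rightarrow> (nat \<Rightarrow> real) \<Rightarrow> real mat" where
  "lower_toeplitz n c = mat n n (\<lambda>(i, j). if j \<le> i then c (i - j) else 0)"

definition prefix_sum :: "nat \<Rightarrow> real mat" where
  "prefix_sum n = lower_toeplitz n (\<lambda>m. 1)"

text \<open>The lower triangular Toeplitz square root of \<open>prefix_sum n\<close>; see \<open>prefix_sqrt_square\<close>.\<close>

definition prefix_sqrt :: "nat \<Rightarrow> real mat" where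
  "prefix_sqrt n = lower_toeplitz n (\<lambda>m. \<bar>(- 1 / 2 :: real) gchoose m\<bar>)"

definition D_Toep :: "nat \<Rightarrow> real mat" where
  "D_Toep n = lower_toeplitz n (\<lambda>m. 1 / real (m + 1))"

text \<open>
  \<open>mat_inverse\<close> returns \<open>None\<close> on singular matrices. All matrices inverted below have
  a nonzero determinant; see \<open>mat_inv\<close> for the resulting characterization.
\<close>

definition mat_inv :: "real mat \<Rightarrow> real mat" where
  "mat_inv C = the (mat_inverse C)"

definition band :: "nat \<Rightarrow> real mat \<Rightarrow> real mat" where
  "band p M = mat (dim_row M) (dim_col M)
     (\<lambda>(i, j). if j \<le> i \<and> i - j < p then M $$ (i, j) else 0)"

definition banded_inverse :: "nat \<Rightarrow> real mat \<Rightarrow> real mat" where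
  "banded_inverse p C = mat_inv (band p (mat_inv C))"

section \<open>Sensitivity and error\<close>

definition frobenius :: "real mat \<Rightarrow> real" where
  "frobenius M = L2_set (\<lambda>ij. M $$ ij) ({..<dim_row M} \<times> {..<dim_col M})"

definition first_rows :: "nat \<Rightarrow> real mat \<Rightarrow> real mat" where
  "first_rows t M = mat t (dim_col M) (\<lambda>(i, j). M $$ (i, j))"

definition participations :: "nat \<Rightarrow> nat \<Rightarrow> nat \<Rightarrow> nat set set" where
  "participations n k b = {\<pi>. \<pi> \<subseteq> {..<n} \<and> card \<pi> \<le> k \<and>
     (\<forall>i\<in>\<pi>. \<forall>j\<in>\<pi>. i \<noteq> j \<longrightarrow> int b \<le> \<bar>int i - int j\<bar>)}"

text \<open>The matrix \<open>\<Sum>i\<in>\<pi>. C\<^bsub>:,i\<^esub> x\<^sub>i\<^sup>T\<close>, a sum of outer products of columns of \<open>C\<close>.\<close>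

definition contribution :: "nat \<Rightarrow> real mat \<Rightarrow> nat set \<Rightarrow> (nat \<Rightarrow> real vec) \<Rightarrow> real mat" where
  "contribution d C \<pi> x = mat (dim_row C) d (\<lambda>(r, s). \<Sum>i\<in>\<pi>. col C i $ r * x i $ s)"

definition admissible :: "nat \<Rightarrow> nat set \<Rightarrow> (nat \<Rightarrow> real vec) set" where
  "admissible d \<pi> = {x. \<forall>i\<in>\<pi>. x i \<in> carrier_vec d \<and> sqrt (x i \<bullet> x i) \<le> 1}"

text \<open>
  The supremum is that of a nonempty set which is bounded (see \<open>contribution_bdd_above\<close>);
  it is a maximum, since only the \<open>x i\<close> with \<open>i \<in> \<pi>\<close> matter and these range over a compact set.
\<close>

definition sens :: "nat \<Rightarrow> nat \<Rightarrow> nat \<Rightarrow> real mat \<Rightarrow> real" where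
  "sens k b d C =
     (MAX \<pi>\<in>participations (dim_col C) k b.
        SUP x\<in>admissible d \<pi>. frobenius (contribution d C \<pi> x))"

definition error_at :: "nat \<Rightarrow> nat \<Rightarrow> nat \<Rightarrow> nat \<Rightarrow> real mat \<Rightarrow> real mat \<Rightarrow> real" where
  "error_at k b d t B C = 1 / sqrt (real t) * frobenius (first_rows t B) * sens k b d C"

definition separation :: "nat \<Rightarrow> nat \<Rightarrow> nat" where
  "separation n k = nat \<lceil>real n / real k\<rceil>"

definition averaging_error :: "nat \<Rightarrow> nat \<Rightarrow> nat \<Rightarrow> nat \<Rightarrow> real mat \<Rightarrow> real" where
  "averaging_error n k d t C =
     error_at k (separation n k) d t (averaging n * mat_inv C) C"

text \<open>
  For a set \<open>S\<close>, the statement \<open>f \<in> O[principal S](g)\<close> says that there is one constant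
  \<open>c > 0\<close> with \<open>\<bar>f x\<bar> \<le> c * \<bar>g x\<bar>\<close> for every \<open>x \<in> S\<close>, without any passage to a limit,
  and similarly for \<open>\<Theta>\<close>. With the set below this expresses absolute constants, valid for all
  \<open>n\<close>, \<open>k\<close>, \<open>d\<close> and \<open>t\<close> at once.
\<close>

definition params :: "(nat \<times> nat \<times> nat \<times> nat) set" where
  "params = {(n, k, d, t). 1 \<le> k \<and> k \<le> n \<and> 1 \<le> d \<and> 1 \<le> t \<and> t \<le> n}"

section \<open>Well-definedness\<close>

lemma bigo_principal_iff:
  "f \<in> O[principal S](g) \<longleftrightarrow> (\<exists>c>0. \<forall>x\<in>S. norm (f x) \<le> c * norm (g x))"
  by (simp add: bigo_def eventually_principal)

lemma lower_toeplitz_carrier [simp]: "lower_toeplitz n c \<in> carrier_mat n n"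
  by (simp add: lower_toeplitz_def)

lemma prefix_sqrt_square: "prefix_sqrt n * prefix_sqrt n = prefix_sum n"
proof -
  define r where "r = (\<lambda>m. \<bar>(- 1 / 2 :: real) gchoose m\<bar>)"
  have r: "r m = (-1) ^ m * ((- 1 / 2) gchoose m)" for m
  proof -
    have "0 \<le> ((1 / 2 + of_nat m - 1 :: real) gchoose m)"
      by (auto simp: gbinomial_prod_rev field_simps intro!: prod_nonneg divide_nonneg_nonneg)
    moreover have "(- 1 / 2 :: real) gchoose m = (-1) ^ m * ((1 / 2 + of_nat m - 1) gchoose m)"
      using gbinomial_minus[of "1/2 :: real" m] by simp
    ultimately show ?thesis
      by (simp add: r_def abs_mult power_abs flip: mult.assoc power_mult_distrib)
  qed
  have conv: "(\<Sum>m=0..N. r m * r (N - m)) = 1" for N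
  proof -
    have "(\<Sum>m=0..N. r m * r (N - m)) =
        (\<Sum>m=0..N. (-1) ^ N * (((- 1 / 2) gchoose m) * ((- 1 / 2) gchoose (N - m))))"
      by (intro sum.cong refl) (simp add: r algebra_simps flip: power_add)
    also have "\<dots> = (-1) ^ N * ((- 1 :: real) gchoose N)"
      using gbinomial_Vandermonde[of "- 1 / 2 :: real" "- 1 / 2" N]
      by (simp flip: sum_distrib_left)
    also have "\<dots> = 1"
      using gbinomial_minus[of "1 :: real" N] binomial_gbinomial[of N N, where ?'a = real]
      by (simp flip: power_mult_distrib mult.assoc)
    finally show ?thesis .
  qed
  show ?thesis
  proof (rule eq_matI)
    fix i j assume "i < dim_row (prefix_sum n)" "j < dim_col (prefix_sum n)"
    then have ij: "i < n" "j < n" by (auto simp: prefix_sum_def lower_toeplitz_def)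
    have "(prefix_sqrt n * prefix_sqrt n) $$ (i, j) =
        (\<Sum>l<n. (if l \<le> i then r (i - l) else 0) * (if j \<le> l then r (l - j) else 0))"
      using ij by (simp add: prefix_sqrt_def lower_toeplitz_def scalar_prod_def r_def atLeast0LessThan cong: if_cong)
    also have "\<dots> = (\<Sum>l\<in>{j..i}. r (i - l) * r (l - j))"
      by (rule sum.mono_neutral_cong_right) (use ij in auto)
    also have "\<dots> = (if j \<le> i then 1 else 0)"
    proof (cases "j \<le> i")
      case True
      have "(\<Sum>l\<in>{j..i}. r (i - l) * r (l - j)) = (\<Sum>m=0..i-j. r m * r (i - j - m))"
        by (rule sum.reindex_bij_witness[of _ "\<lambda>m. i - m" "\<lambda>l. i - l"]) (use True in auto)
      with conv[of "i - j"] True show ?thesis by presburger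
    qed simp
    finally show "(prefix_sqrt n * prefix_sqrt n) $$ (i, j) = prefix_sum n $$ (i, j)"
      using ij by (simp add: prefix_sum_def lower_toeplitz_def)
  qed (simp_all add: prefix_sum_def prefix_sqrt_def lower_toeplitz_def)
qed

lemma mat_inv:
  assumes "C \<in> carrier_mat n n" "det C \<noteq> 0"
  shows "mat_inv C \<in> carrier_mat n n" "C * mat_inv C = 1\<^sub>m n" "mat_inv C * C = 1\<^sub>m n"
proof -
  have "mat_inverse C \<noteq> None"
    using mat_inverse(1)[OF assms(1), of "()"] det_non_zero_imp_unit[OF assms, of "()"] by blast
  then have "mat_inverse C = Some (mat_inv C)" by (auto simp: mat_inv_def)
  from mat_inverse(2)[OF assms(1) this]
  show "mat_inv C \<in> carrier_mat n n" "C * mat_inv C = 1\<^sub>m n" "mat_inv C * C = 1\<^sub>m n" by auto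
qed

definition unit_lower :: "nat \<Rightarrow> real mat \<Rightarrow> bool" where
  "unit_lower n C \<longleftrightarrow> C \<in> carrier_mat n n \<and>
     (\<forall>i<n. C $$ (i, i) = 1) \<and> (\<forall>i j. i < j \<longrightarrow> j < n \<longrightarrow> C $$ (i, j) = 0)"

lemma unit_lower_det: "unit_lower n C \<Longrightarrow> det C = 1"
  by (subst det_lower_triangular[of n]) (auto simp: unit_lower_def prod_list_diag_prod)

lemma unit_lower_mat_inv:
  assumes C: "unit_lower n C"
  shows "unit_lower n (mat_inv C)"
proof -
  let ?X = "mat_inv C"
  have carr: "C \<in> carrier_mat n n" using C by (simp add: unit_lower_def)
  have X: "?X \<in> carrier_mat n n" "C * ?X = 1\<^sub>m n"
    using mat_inv[OF carr] unit_lower_det[OF C] by auto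
  have *: "?X $$ (i, j) = (if i = j then 1 else 0)" if "i \<le> j" "j < n" for i j
    using that
  proof (induction i rule: less_induct)
    case (less i)
    have "(if i = j then 1 else 0) = (C * ?X) $$ (i, j)"
      using X less.prems by simp
    also have "\<dots> = (\<Sum>l<n. C $$ (i, l) * ?X $$ (l, j))"
      using X(1) carr less.prems by (simp add: scalar_prod_def atLeast0LessThan)
    also have "\<dots> = (\<Sum>l\<in>{i}. C $$ (i, l) * ?X $$ (l, j))"
    proof (rule sum.mono_neutral_right)
      show "\<forall>l\<in>{..<n} - {i}. C $$ (i, l) * ?X $$ (l, j) = 0"
      proof
        fix l assume l: "l \<in> {..<n} - {i}"
        show "C $$ (i, l) * ?X $$ (l, j) = 0"
        proof (cases "l < i")
          case True
          with less.IH[of l] less.prems show ?thesis by simp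
        next
          case False
          with l C show ?thesis by (simp add: unit_lower_def)
        qed
      qed
    qed (use less.prems in auto)
    also have "\<dots> = ?X $$ (i, j)" using C less.prems by (simp add: unit_lower_def)
    finally show ?case by simp
  qed
  show ?thesis using X(1) * by (auto simp: unit_lower_def)
qed

lemma unit_lower_band: "unit_lower n M \<Longrightarrow> 1 \<le> p \<Longrightarrow> unit_lower n (band p M)"
  by (auto simp: unit_lower_def band_def)

lemma unit_lower_banded_inverse:
  "unit_lower n C \<Longrightarrow> 1 \<le> p \<Longrightarrow> unit_lower n (banded_inverse p C)"
  unfolding banded_inverse_def by (intro unit_lower_mat_inv unit_lower_band)

lemma mat_inv_banded_inverse:
  assumes "unit_lower n C" "1 \<le> p"
  shows "mat_inv (banded_inverse p C) = band p (mat_inv C)"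
proof -
  let ?M = "band p (mat_inv C)" and ?D = "banded_inverse p C"
  have M: "unit_lower n ?M" and D: "unit_lower n ?D"
    using assms by (auto intro: unit_lower_band unit_lower_mat_inv unit_lower_banded_inverse)
  have carr: "?M \<in> carrier_mat n n" "?D \<in> carrier_mat n n"
    using M D by (auto simp: unit_lower_def)
  note Di = mat_inv[OF carr(2), unfolded unit_lower_det[OF D], simplified]
  have MD: "?M * ?D = 1\<^sub>m n"
    using mat_inv(2)[OF carr(1)] unit_lower_det[OF M] by (simp add: banded_inverse_def)
  have "mat_inv ?D = (?M * ?D) * mat_inv ?D"
    using MD Di(1) by simp
  also have "\<dots> = ?M * (?D * mat_inv ?D)"
    using carr Di(1) by (rule assoc_mult_mat)
  finally show ?thesis using Di(2) carr(1) by simp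
qed

lemma unit_lower_choices:
  "unit_lower n (prefix_sqrt n)" "unit_lower n (1\<^sub>m n)" "unit_lower n (D_Toep n)"
  by (auto simp: unit_lower_def prefix_sqrt_def D_Toep_def lower_toeplitz_def)

lemma averaging_factorization:
  assumes "unit_lower n C"
  shows "averaging n * mat_inv C * C = averaging n"
proof -
  have C: "C \<in> carrier_mat n n" using assms by (simp add: unit_lower_def)
  note inv = mat_inv[OF C, unfolded unit_lower_det[OF assms], simplified]
  have A: "averaging n \<in> carrier_mat n n" by (simp add: averaging_def)
  show ?thesis using assoc_mult_mat[OF A inv(1) C] inv(3) A by simp
qed

lemma finite_participations: "finite (participations n k b)"
  by (rule finite_subset[of _ "Pow {..<n}"]) (auto simp: participations_def)

lemma empty_participations: "{} \<in> participations n k b"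
  by (simp add: participations_def)

lemma zero_admissible: "(\<lambda>_. 0\<^sub>v d) \<in> admissible d \<pi>"
  by (simp add: admissible_def)

lemma contribution_bdd_above:
  "bdd_above ((\<lambda>x. frobenius (contribution d C \<pi> x)) ` admissible d \<pi>)"
proof (rule bdd_aboveI2)
  fix x assume x: "x \<in> admissible d \<pi>"
  let ?S = "{..<dim_row C} \<times> {..<d}"
  have le1: "\<bar>x i $ s\<bar> \<le> 1" if "i \<in> \<pi>" "s < d" for i s
  proof -
    have xi: "x i \<in> carrier_vec d" "x i \<bullet> x i \<le> 1"
      using x that by (auto simp: admissible_def)
    have "(x i $ s)\<^sup>2 \<le> (\<Sum>l<d. (x i $ l)\<^sup>2)"
      using that by (intro member_le_sum) auto
    also have "\<dots> = x i \<bullet> x i"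
      using xi(1) by (simp add: scalar_prod_def atLeast0LessThan power2_eq_square)
    finally show ?thesis using xi(2) abs_square_le_1[of "x i $ s"] by linarith
  qed
  have "frobenius (contribution d C \<pi> x)
      = L2_set (\<lambda>ij. contribution d C \<pi> x $$ ij) ?S"
    by (simp add: frobenius_def contribution_def)
  also have "\<dots> \<le> (\<Sum>ij\<in>?S. \<bar>contribution d C \<pi> x $$ ij\<bar>)"
    by (rule L2_set_le_sum_abs)
  also have "\<dots> \<le> (\<Sum>ij\<in>?S. \<Sum>i\<in>\<pi>. \<bar>col C i $ fst ij\<bar>)"
  proof (rule sum_mono)
    fix ij assume "ij \<in> ?S"
    then obtain r s where ij: "ij = (r, s)" "r < dim_row C" "s < d" by auto
    have "\<bar>\<Sum>i\<in>\<pi>. col C i $ r * x i $ s\<bar> \<le> (\<Sum>i\<in>\<pi>. \<bar>col C i $ r * x i $ s\<bar>)"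
      by (rule sum_abs)
    also have "\<dots> \<le> (\<Sum>i\<in>\<pi>. \<bar>col C i $ r\<bar>)"
      by (rule sum_mono) (use le1 ij in \<open>auto simp: abs_mult intro!: mult_left_le\<close>)
    finally show "\<bar>contribution d C \<pi> x $$ ij\<bar> \<le> (\<Sum>i\<in>\<pi>. \<bar>col C i $ fst ij\<bar>)"
      using ij by (simp add: contribution_def)
  qed
  finally show "frobenius (contribution d C \<pi> x) \<le> (\<Sum>ij\<in>?S. \<Sum>i\<in>\<pi>. \<bar>col C i $ fst ij\<bar>)" .
qed

end

theory Submission
  imports
    Defs
    "HOL-Analysis.Harmonic_Numbers"
    "HOL-Analysis.Henstock_Kurzweil_Integration"
begin

text \<open>
  Write \<open>C\<close> as the Toeplitz matrix of a power series \<open>f\<close> with \<open>f\<^sub>0 = 1\<close>. Then the entries of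
  \<open>A C\<inverse>\<close> are \<open>W\<^bsub>i-j\<^esub> / (i + 1)\<close> for \<open>W = 1 / ((1 - x) f)\<close>, so the row norms are governed by
  \<open>\<Sum>j. W\<^sub>j\<^sup>2 / (j + 1)\<close>. If \<open>f\<close> has nonnegative decreasing coefficients with sum \<open>S\<close> and sum of
  squares \<open>Q\<close>, then \<open>sens\<^sup>2 \<le> 2 k (Q + S\<^sup>2 / b)\<close>: in each row all participations except the
  latest one lie \<open>b\<close> apart and are compared with averages of \<open>f\<close> over disjoint windows.

  Passing to the \<open>p\<close>-banded inverse replaces \<open>W\<^sub>j\<close> by \<open>W\<^bsub>min j (p-1)\<^esub>\<close>. For both
  \<open>prefix_sqrt\<close> and \<open>D_Toep\<close> the sequence \<open>W\<close> is decreasing and log-convex, and this is preserved. By Kaluza's theorem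
  the reciprocal of such a series has nonpositive coefficients after the first one, hence the
  coefficients of the banded inverse decrease; convolving them with \<open>W\<close> bounds their sum by
  \<open>1 / W\<^bsub>p-1\<^esub>\<close>.
\<close>

text \<open>Each error is a row factor \<open>sum of W_j^2 / (j + 1)\<close> times
  \<open>Q + S^2 / b\<close>, up to constants and \<open>k / t\<close>, and the choice of
  \<open>f\<close> trades one for the other. For \<open>f = 1\<close> the second factor is constant
  but the first is harmonic. For \<open>prefix_sqrt\<close>, \<open>f * f = 1 / (1 - x)\<close>
  gives \<open>W = f\<close>: the row factor is bounded, \<open>Q\<close> is logarithmic and
  \<open>S\<close> is of order \<open>sqrt n\<close>. For \<open>D_Toep\<close> the row factor and
  \<open>Q\<close> are both bounded and only \<open>S\<close> grows, logarithmically. Banding caps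
  \<open>S\<close> at the price of a \<open>W\<close> that stops decaying.

  The banded inverse has no explicit coefficients beyond the band, yet the sensitivity bound needs
  them nonnegative and decreasing; this is what log-convexity is for. It survives banding because
  the ratios of consecutive \<open>W_j\<close> increase, never exceed 1, and become 1 once
  \<open>W\<close> is frozen.

  For \<open>D_Toep\<close> even \<open>W\<close> lacks a convenient formula. Writing its series as
  an integral of \<open>(1 - x)^(s - 1)\<close> over \<open>s\<close> in \<open>[0, 1]\<close>
  exhibits the coefficients as averages of explicit log-convex sequences, and averaging preserves
  log-convexity.

  The lower bounds use a single participation pattern, the multiples of \<open>b\<close>.\<close>

unbundle no vec_syntax

section \<open>Toeplitz matrices and power series\<close>

text \<open>Stated without an index so that it also rewrites
  \<open>antimono (fps_nth (Abs_fps f))\<close>.\<close>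

lemma fps_nth_Abs_fps [simp]: "fps_nth (Abs_fps f) = f"
  by auto

definition toep :: "nat \<Rightarrow> real fps \<Rightarrow> real mat" where
  "toep n f = lower_toeplitz n (fps_nth f)"

definition ones :: "real fps" where
  "ones = Abs_fps (\<lambda>_. 1)"

lemma ones_nth [simp]: "fps_nth ones m = 1"
  by (simp add: ones_def)

lemma ones_mult_nth: "fps_nth (ones * f) m = (\<Sum>j\<le>m. fps_nth f j)"
  by (subst mult.commute) (simp add: fps_mult_nth atLeast0AtMost)

lemma toep_carrier [simp]: "toep n f \<in> carrier_mat n n"
  by (simp add: toep_def)

lemma toep_dims [simp]: "dim_row (toep n f) = n" "dim_col (toep n f) = n"
  using toep_carrier carrier_matD by blast+

lemma toep_nth [simp]:
  "i < n \<Longrightarrow> j < n \<Longrightarrow> toep n f $$ (i, j) = (if j \<le> i then fps_nth f (i - j) else 0)"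
  by (simp add: toep_def lower_toeplitz_def)

text \<open>Kept as a bare sum because it serves twice: for products of Toeplitz matrices, and for
  \<open>averaging n\<close>, which is not Toeplitz but whose row \<open>i\<close> is that of
  \<open>toep n ones\<close> divided by \<open>i + 1\<close>.\<close>

lemma toep_mult_nth:
  fixes f g :: "real fps"
  assumes "i < n" "j < n"
  shows "(\<Sum>l<n. (if l \<le> i then fps_nth f (i - l) else 0) * (if j \<le> l then fps_nth g (l - j) else 0))
    = (if j \<le> i then fps_nth (f * g) (i - j) else 0)"
proof -
  have "(\<Sum>l<n. (if l \<le> i then fps_nth f (i - l) else 0) * (if j \<le> l then fps_nth g (l - j) else 0))
      = (\<Sum>l\<in>{j..i}. fps_nth f (i - l) * fps_nth g (l - j))"
    by (rule sum.mono_neutral_cong_right) (use assms in auto)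
  also have "\<dots> = (if j \<le> i then fps_nth (f * g) (i - j) else 0)"
  proof (cases "j \<le> i")
    case True
    have "(\<Sum>l\<in>{j..i}. fps_nth f (i - l) * fps_nth g (l - j))
        = (\<Sum>m=0..i-j. fps_nth f m * fps_nth g (i - j - m))"
      by (rule sum.reindex_bij_witness[of _ "\<lambda>m. i - m" "\<lambda>l. i - l"]) (use True in auto)
    with True show ?thesis by (simp add: fps_mult_nth)
  qed simp
  finally show ?thesis .
qed

lemma toep_mult: "toep n f * toep n g = toep n (f * g)"
proof (rule eq_matI)
  fix i j assume "i < dim_row (toep n (f * g))" "j < dim_col (toep n (f * g))"
  then have ij: "i < n" "j < n" by auto
  have "(toep n f * toep n g) $$ (i, j) = (\<Sum>l<n. (if l \<le> i then fps_nth f (i - l) else 0)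
      * (if j \<le> l then fps_nth g (l - j) else 0))"
    using ij by (simp add: scalar_prod_def atLeast0LessThan cong: if_cong)
  also have "\<dots> = toep n (f * g) $$ (i, j)"
    using toep_mult_nth[OF ij] toep_nth[OF ij] by presburger
  finally show "(toep n f * toep n g) $$ (i, j) = toep n (f * g) $$ (i, j)" .
qed auto

lemma toep_one: "toep n 1 = 1\<^sub>m n"
  by (rule eq_matI) auto

lemma toep_unit_lower: "fps_nth f 0 = 1 \<Longrightarrow> unit_lower n (toep n f)"
  by (auto simp: unit_lower_def)

lemma mat_inv_toep:
  assumes "fps_nth f 0 = 1"
  shows "mat_inv (toep n f) = toep n (inverse f)"
proof -
  let ?C = "toep n f"
  have "det ?C \<noteq> 0"
    using unit_lower_det[OF toep_unit_lower[OF assms]] by simp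
  note inv = mat_inv[OF toep_carrier this]
  have "toep n (inverse f) * ?C = 1\<^sub>m n"
    using assms by (simp add: toep_mult inverse_mult_eq_1 toep_one)
  then have "mat_inv ?C = (toep n (inverse f) * ?C) * mat_inv ?C"
    using inv(1) by simp
  also have "\<dots> = toep n (inverse f) * (?C * mat_inv ?C)"
    using toep_carrier toep_carrier inv(1) by (rule assoc_mult_mat)
  finally show ?thesis using inv(2) by simp
qed

lemma band_toep: "band p (toep n f) = toep n (fps_cutoff p f)"
  by (rule eq_matI) (auto simp: band_def)

text \<open>Banding is truncation of the reciprocal series, so the banded inverse comes from one
  series that does not depend on \<open>n\<close>.\<close>

lemma banded_inverse_toep:
  assumes "fps_nth f 0 = 1" "1 \<le> p"
  shows "banded_inverse p (toep n f) = toep n (inverse (fps_cutoff p (inverse f)))"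
  using assms by (simp add: banded_inverse_def mat_inv_toep band_toep)

section \<open>Row norms of the averaging matrix times an inverse Toeplitz matrix\<close>

lemma averaging_mult_toep_nth:
  assumes "i < n" "j < n"
  shows "(averaging n * toep n f) $$ (i, j)
    = (if j \<le> i then fps_nth (ones * f) (i - j) / real (i + 1) else 0)"
proof -
  have "(averaging n * toep n f) $$ (i, j) = (\<Sum>l<n. (if l \<le> i then 1 / real (i + 1) else 0)
      * (if j \<le> l then fps_nth f (l - j) else 0))"
    using assms by (simp add: averaging_def scalar_prod_def atLeast0LessThan cong: if_cong)
  also have "\<dots> = (\<Sum>l<n. (if l \<le> i then fps_nth ones (i - l) else 0)
      * (if j \<le> l then fps_nth f (l - j) else 0)) / real (i + 1)"
    unfolding sum_divide_distrib by (intro sum.cong) auto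
  finally show ?thesis unfolding toep_mult_nth[OF assms] by (simp del: of_nat_Suc)
qed

lemma frobenius_averaging_toep:
  assumes f: "fps_nth f 0 = 1" and w: "ones * inverse f = W" and t: "t \<le> n"
  shows "frobenius (first_rows t (averaging n * mat_inv (toep n f)))
    = sqrt (\<Sum>i<t. (\<Sum>j\<le>i. (fps_nth W j)\<^sup>2) / (real (i + 1))\<^sup>2)"
proof -
  let ?B = "averaging n * toep n (inverse f)"
  have dims: "dim_col ?B = n" by simp
  have "(\<Sum>ij\<in>{..<t} \<times> {..<n}. (first_rows t ?B $$ ij)\<^sup>2)
      = (\<Sum>i<t. \<Sum>j<n. (first_rows t ?B $$ (i, j))\<^sup>2)"
    by (simp add: sum.cartesian_product)
  also have "\<dots> = (\<Sum>i<t. (\<Sum>j\<le>i. (fps_nth W j)\<^sup>2) / (real (i + 1))\<^sup>2)"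
  proof (rule sum.cong[OF refl])
    fix i assume "i \<in> {..<t}"
    then have i: "i < t" "i < n" using t by auto
    have "(\<Sum>j<n. (first_rows t ?B $$ (i, j))\<^sup>2)
        = (\<Sum>j<n. if j \<le> i then (fps_nth W (i - j))\<^sup>2 / (real (i + 1))\<^sup>2 else 0)"
    proof (rule sum.cong[OF refl])
      fix j assume "j \<in> {..<n}"
      then have "first_rows t ?B $$ (i, j) = ?B $$ (i, j)" "j < n"
        using i by (simp_all add: first_rows_def)
      then show "(first_rows t ?B $$ (i, j))\<^sup>2
          = (if j \<le> i then (fps_nth W (i - j))\<^sup>2 / (real (i + 1))\<^sup>2 else 0)"
        using averaging_mult_toep_nth[OF i(2), of j "inverse f"] by (simp add: w power_divide)
    qed
    also have "\<dots> = (\<Sum>j\<le>i. (fps_nth W (i - j))\<^sup>2 / (real (i + 1))\<^sup>2)"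
      by (rule sum.mono_neutral_cong_right) (use i in auto)
    also have "\<dots> = (\<Sum>j\<le>i. (fps_nth W j)\<^sup>2 / (real (i + 1))\<^sup>2)"
      by (rule sum.reindex_bij_witness[of _ "\<lambda>j. i - j" "\<lambda>j. i - j"]) auto
    finally show "(\<Sum>j<n. (first_rows t ?B $$ (i, j))\<^sup>2)
        = (\<Sum>j\<le>i. (fps_nth W j)\<^sup>2) / (real (i + 1))\<^sup>2"
      by (simp add: sum_divide_distrib)
  qed
  finally show ?thesis
    by (simp add: frobenius_def L2_set_def mat_inv_toep[OF f] first_rows_def)
qed

lemma sum_inverse_squares_tail:
  assumes "1 \<le> a"
  shows "(\<Sum>i=a..N. 1 / (real i)\<^sup>2) \<le> 2 / real a"
proof -
  \<comment> \<open>Subtracting \<open>1 / N\<close> makes the induction telescope: the next term is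
    at most \<open>1 / N - 1 / (N + 1)\<close>.\<close>
  have "(\<Sum>i=a..N. 1 / (real i)\<^sup>2) \<le> 2 / real a - (if a \<le> N then 1 / real N else 0)"
  proof (induction N)
    case (Suc N)
    show ?case
    proof (cases "a \<le> N")
      case True
      then have N: "real N > 0" using assms by simp
      have "1 / (real (Suc N))\<^sup>2 \<le> 1 / (real N * real (Suc N))"
        using N by (intro divide_left_mono) (auto simp: power2_eq_square)
      also have "\<dots> = 1 / real N - 1 / real (Suc N)"
        using N by (simp add: field_simps)
      finally have "1 / (real (Suc N))\<^sup>2 \<le> 1 / real N - 1 / real (Suc N)" .
      with Suc True show ?thesis by simp
    next
      case False
      show ?thesis
      proof (cases "a = Suc N")
        case True
        then have "1 / (real a)\<^sup>2 \<le> 1 / real a"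
          using assms by (intro divide_left_mono) (auto simp: power2_eq_square)
        with True show ?thesis by simp
      qed (use False assms in auto)
    qed
  qed (use assms in auto)
  then show ?thesis by (smt (verit) divide_nonneg_nonneg of_nat_0_le_iff)
qed

text \<open>\<open>w j\<close> occurs in every row from \<open>j\<close> on. Exchanging the sums
  gives its square the weight \<open>1 / (j + 1)^2 + 1 / (j + 2)^2 + ...\<close>, at most
  \<open>2 / (j + 1)\<close>.\<close>

lemma averaging_row_norms_le:
  assumes "\<And>j. j < t \<Longrightarrow> (w j)\<^sup>2 \<le> u j"
  shows "(\<Sum>i<t. (\<Sum>j\<le>i. (w j :: real)\<^sup>2) / (real (i + 1))\<^sup>2) \<le> 2 * (\<Sum>j<t. u j / real (j + 1))"
proof -
  have "(\<Sum>i<t. (\<Sum>j\<le>i. (w j)\<^sup>2) / (real (i + 1))\<^sup>2)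
      = (\<Sum>i<t. \<Sum>j<t. if j \<le> i then (w j)\<^sup>2 * (1 / (real (i + 1))\<^sup>2) else 0)"
  proof (rule sum.cong[OF refl])
    fix i assume "i \<in> {..<t}"
    then show "(\<Sum>j\<le>i. (w j)\<^sup>2) / (real (i + 1))\<^sup>2
        = (\<Sum>j<t. if j \<le> i then (w j)\<^sup>2 * (1 / (real (i + 1))\<^sup>2) else 0)"
      unfolding sum_divide_distrib by (intro sum.mono_neutral_cong_left) auto
  qed
  also have "\<dots> = (\<Sum>j<t. \<Sum>i<t. if j \<le> i then (w j)\<^sup>2 * (1 / (real (i + 1))\<^sup>2) else 0)"
    by (rule sum.swap)
  also have "\<dots> = (\<Sum>j<t. (w j)\<^sup>2 * (\<Sum>i=j+1..t. 1 / (real i)\<^sup>2))"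
  proof (rule sum.cong[OF refl])
    fix j assume "j \<in> {..<t}"
    have "(\<Sum>i<t. if j \<le> i then (w j)\<^sup>2 * (1 / (real (i + 1))\<^sup>2) else 0)
        = (\<Sum>i\<in>{j..<t}. (w j)\<^sup>2 * (1 / (real (i + 1))\<^sup>2))"
      by (rule sum.mono_neutral_cong_right) auto
    also have "\<dots> = (\<Sum>i=j+1..t. (w j)\<^sup>2 * (1 / (real i)\<^sup>2))"
      by (rule sum.reindex_bij_witness[of _ "\<lambda>i. i - 1" "\<lambda>i. i + 1"]) auto
    finally show "(\<Sum>i<t. if j \<le> i then (w j)\<^sup>2 * (1 / (real (i + 1))\<^sup>2) else 0)
        = (w j)\<^sup>2 * (\<Sum>i=j+1..t. 1 / (real i)\<^sup>2)"
      by (simp add: sum_distrib_left)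
  qed
  also have "\<dots> \<le> (\<Sum>j<t. u j * (2 / real (j + 1)))"
    by (intro sum_mono mult_mono sum_inverse_squares_tail assms sum_nonneg)
      (auto intro: order_trans[OF zero_le_power2 assms])
  finally show ?thesis by (simp add: sum_distrib_left mult.commute)
qed

section \<open>Sensitivity of Toeplitz matrices\<close>

lemma separation_bounds:
  assumes "1 \<le> k" "k \<le> n"
  shows "1 \<le> separation n k" "real n / real k \<le> real (separation n k)"
    "real (separation n k) \<le> 2 * (real n / real k)" "n \<le> separation n k * k"
proof -
  have ge1: "real n / real k \<ge> 1" using assms by simp
  have b: "real (separation n k) = of_int \<lceil>real n / real k\<rceil>"
    using ge1 by (simp add: separation_def)
  then show ge: "real n / real k \<le> real (separation n k)" by linarith
  then show "1 \<le> separation n k" using ge1 by linarith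
  show "real (separation n k) \<le> 2 * (real n / real k)" using b ge1 by linarith
  have "real n \<le> real (separation n k * k)" using ge assms by (simp add: field_simps)
  then show "n \<le> separation n k * k" by linarith
qed

lemma L2_set_sum_le: "L2_set (\<lambda>s. \<Sum>i\<in>I. f i s) A \<le> (\<Sum>i\<in>I. L2_set (f i) A)"
proof (induction I rule: infinite_finite_induct)
  case (insert i I)
  then show ?case
    using L2_set_triangle_ineq[of "f i" "\<lambda>s. \<Sum>i\<in>I. f i s" A] by simp
qed (simp_all add: L2_set_def)

text \<open>Row \<open>r\<close> of the contribution is a combination of vectors of norm at most 1
  with coefficients \<open>C $$ (r, i)\<close>; the triangle inequality removes the dimension
  \<open>d\<close>.\<close>

lemma frobenius_contribution_le:
  assumes \<pi>: "\<pi> \<subseteq> {..<dim_col C}" and x: "x \<in> admissible d \<pi>"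
  shows "frobenius (contribution d C \<pi> x)
    \<le> sqrt (\<Sum>r<dim_row C. (\<Sum>i\<in>\<pi>. \<bar>C $$ (r, i)\<bar>)\<^sup>2)"
proof -
  have row: "(\<Sum>s<d. (\<Sum>i\<in>\<pi>. C $$ (r, i) * x i $ s)\<^sup>2) \<le> (\<Sum>i\<in>\<pi>. \<bar>C $$ (r, i)\<bar>)\<^sup>2" for r
  proof -
    have "L2_set (\<lambda>s. \<Sum>i\<in>\<pi>. C $$ (r, i) * x i $ s) {..<d}
        \<le> (\<Sum>i\<in>\<pi>. L2_set (\<lambda>s. C $$ (r, i) * x i $ s) {..<d})"
      by (rule L2_set_sum_le)
    also have "\<dots> \<le> (\<Sum>i\<in>\<pi>. \<bar>C $$ (r, i)\<bar>)"
    proof (rule sum_mono)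
      fix i assume "i \<in> \<pi>"
      with x have xi: "x i \<in> carrier_vec d" "sqrt (x i \<bullet> x i) \<le> 1"
        by (auto simp: admissible_def)
      have "L2_set (\<lambda>s. C $$ (r, i) * x i $ s) {..<d} = \<bar>C $$ (r, i)\<bar> * sqrt (x i \<bullet> x i)"
        using xi(1) by (simp add: L2_set_def scalar_prod_def atLeast0LessThan power_mult_distrib
            real_sqrt_mult power2_eq_square[of "x i $ _"] flip: sum_distrib_left)
      also have "\<dots> \<le> \<bar>C $$ (r, i)\<bar>" using xi(2) by (simp add: mult_left_le)
      finally show "L2_set (\<lambda>s. C $$ (r, i) * x i $ s) {..<d} \<le> \<bar>C $$ (r, i)\<bar>" .
    qed
    finally show ?thesis
      unfolding L2_set_def by (rule sqrt_le_D)
  qed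
  have "frobenius (contribution d C \<pi> x)
      = sqrt (\<Sum>(r, s)\<in>{..<dim_row C} \<times> {..<d}. (\<Sum>i\<in>\<pi>. col C i $ r * x i $ s)\<^sup>2)"
    by (auto simp: frobenius_def contribution_def L2_set_def intro!: sum.cong)
  also have "\<dots> = sqrt (\<Sum>r<dim_row C. \<Sum>s<d. (\<Sum>i\<in>\<pi>. col C i $ r * x i $ s)\<^sup>2)"
    by (simp add: sum.cartesian_product)
  also have "\<dots> = sqrt (\<Sum>r<dim_row C. \<Sum>s<d. (\<Sum>i\<in>\<pi>. C $$ (r, i) * x i $ s)\<^sup>2)"
    using \<pi> by (intro arg_cong[of _ _ sqrt] arg_cong[of _ _ "\<lambda>u. u\<^sup>2"] sum.cong) auto
  also have "\<dots> \<le> sqrt (\<Sum>r<dim_row C. (\<Sum>i\<in>\<pi>. \<bar>C $$ (r, i)\<bar>)\<^sup>2)"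
    by (intro real_sqrt_le_mono sum_mono row)
  finally show ?thesis .
qed

lemma sens_leI:
  assumes "\<And>\<pi>. \<pi> \<in> participations (dim_col C) k b \<Longrightarrow>
    (\<Sum>r<dim_row C. (\<Sum>i\<in>\<pi>. \<bar>C $$ (r, i)\<bar>)\<^sup>2) \<le> M"
  shows "sens k b d C \<le> sqrt M"
  unfolding sens_def
proof (rule Max.boundedI)
  fix a assume "a \<in> (\<lambda>\<pi>. SUP x\<in>admissible d \<pi>. frobenius (contribution d C \<pi> x)) `
    participations (dim_col C) k b"
  then obtain \<pi> where \<pi>: "\<pi> \<in> participations (dim_col C) k b"
    and a: "a = (SUP x\<in>admissible d \<pi>. frobenius (contribution d C \<pi> x))" by auto
  show "a \<le> sqrt M" unfolding a
  proof (rule cSUP_least)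
    fix x assume "x \<in> admissible d \<pi>"
    with \<pi> have "frobenius (contribution d C \<pi> x)
        \<le> sqrt (\<Sum>r<dim_row C. (\<Sum>i\<in>\<pi>. \<bar>C $$ (r, i)\<bar>)\<^sup>2)"
      by (intro frobenius_contribution_le) (auto simp: participations_def)
    also have "\<dots> \<le> sqrt M" using assms[OF \<pi>] by simp
    finally show "frobenius (contribution d C \<pi> x) \<le> sqrt M" .
  qed (use zero_admissible in auto)
qed (use finite_participations empty_participations in blast)+

text \<open>All participants contribute the same unit vector, so no cancellation occurs between
  entries of equal sign; for nonnegative entries this meets the expression in
  \<open>sens_leI\<close>.\<close>

lemma sens_geI:
  assumes \<pi>: "\<pi> \<in> participations (dim_col C) k b" and d: "1 \<le> d"
    and M: "M \<le> (\<Sum>r<dim_row C. (\<Sum>i\<in>\<pi>. C $$ (r, i))\<^sup>2)"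
  shows "sqrt M \<le> sens k b d C"
proof -
  let ?x = "\<lambda>_::nat. unit_vec d 0 :: real Matrix.vec"
  let ?F = "\<lambda>\<pi>. SUP x\<in>admissible d \<pi>. frobenius (contribution d C \<pi> x)"
  have x: "?x \<in> admissible d \<pi>" using d by (auto simp: admissible_def)
  have sub: "\<pi> \<subseteq> {..<dim_col C}" using \<pi> by (simp add: participations_def)
  have "(\<Sum>r<dim_row C. (\<Sum>i\<in>\<pi>. C $$ (r, i))\<^sup>2)
      = (\<Sum>(r, s)\<in>{..<dim_row C} \<times> {0::nat}. (\<Sum>i\<in>\<pi>. C $$ (r, i))\<^sup>2)"
    by (simp flip: sum.cartesian_product)
  also have "\<dots> = (\<Sum>(r, s)\<in>{..<dim_row C} \<times> {0::nat}. (\<Sum>i\<in>\<pi>. col C i $ r * ?x i $ s)\<^sup>2)"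
    using sub d by (auto intro!: sum.cong arg_cong[of _ _ "\<lambda>u. u\<^sup>2"])
  also have "\<dots> \<le> (\<Sum>(r, s)\<in>{..<dim_row C} \<times> {..<d}. (\<Sum>i\<in>\<pi>. col C i $ r * ?x i $ s)\<^sup>2)"
    by (rule sum_mono2) (use d in auto)
  also have "sqrt \<dots> = frobenius (contribution d C \<pi> ?x)"
    by (auto simp: frobenius_def contribution_def L2_set_def intro!: sum.cong)
  finally have "sqrt M \<le> frobenius (contribution d C \<pi> ?x)"
    using M by (meson order_trans real_sqrt_le_iff)
  also have "\<dots> \<le> ?F \<pi>"
    by (rule cSUP_upper[OF x contribution_bdd_above])
  also have "\<dots> \<le> sens k b d C"
    unfolding sens_def by (rule Max_ge) (use \<pi> finite_participations in auto)
  finally show ?thesis .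
qed

text \<open>
  Every element of \<open>A\<close> except the least one is preceded by \<open>b\<close> indices at which \<open>q\<close> is
  at least as large, and these windows are disjoint.
\<close>

lemma separated_sum_le:
  fixes q :: "nat \<Rightarrow> real"
  assumes q: "antimono q" "\<And>m. 0 \<le> q m" and b: "1 \<le> b" and A: "A \<subseteq> {..<N}"
    and sep: "\<And>x y. x \<in> A \<Longrightarrow> y \<in> A \<Longrightarrow> x < y \<Longrightarrow> x + b \<le> y"
  shows "(\<Sum>a\<in>A. q a)\<^sup>2 \<le> 2 * (\<Sum>a\<in>A. (q a)\<^sup>2) + 2 * ((\<Sum>m<N. q m) / real b)\<^sup>2"
proof (cases "A = {}")
  case False
  have fin: "finite A" using A finite_subset by blast
  define z where "z = Min A"
  have z: "z \<in> A" "\<And>a. a \<in> A \<Longrightarrow> z \<le> a" using fin False by (auto simp: z_def)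
  have ge_b: "b \<le> a" if "a \<in> A - {z}" for a
    using sep[of z a] z that by force
  have "real b * (\<Sum>a\<in>A - {z}. q a) \<le> (\<Sum>a\<in>A - {z}. \<Sum>m\<in>{a - b..<a}. q m)"
    unfolding sum_distrib_left
  proof (rule sum_mono)
    fix a assume a: "a \<in> A - {z}"
    have "real b * q a = (\<Sum>m\<in>{a - b..<a}. q a)" using ge_b[OF a] by simp
    also have "\<dots> \<le> (\<Sum>m\<in>{a - b..<a}. q m)"
      by (intro sum_mono antimonoD[OF q(1)]) auto
    finally show "real b * q a \<le> (\<Sum>m\<in>{a - b..<a}. q m)" .
  qed
  also have "\<dots> = (\<Sum>m\<in>(\<Union>a\<in>A - {z}. {a - b..<a}). q m)"
  proof (rule sum.UNION_disjoint[symmetric])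
    show "\<forall>x\<in>A - {z}. \<forall>y\<in>A - {z}. x \<noteq> y \<longrightarrow> {x - b..<x} \<inter> {y - b..<y} = {}"
    proof (intro ballI impI)
      fix x y assume "x \<in> A - {z}" "y \<in> A - {z}" "x \<noteq> y"
      then show "{x - b..<x} \<inter> {y - b..<y} = {}"
        using sep[of x y] sep[of y x] by (cases x y rule: linorder_cases) auto
    qed
  qed (use fin in auto)
  also have "\<dots> \<le> (\<Sum>m<N. q m)"
    by (rule sum_mono2) (use A q in auto)
  finally have rest: "(\<Sum>a\<in>A - {z}. q a) \<le> (\<Sum>m<N. q m) / real b"
    using b by (simp add: field_simps)
  have "(\<Sum>a\<in>A. q a)\<^sup>2 = (q z + (\<Sum>a\<in>A - {z}. q a))\<^sup>2"
    using fin z by (simp add: sum.remove)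
  also have "\<dots> \<le> (q z + (\<Sum>m<N. q m) / real b)\<^sup>2"
    using rest q(2) by (intro power_mono add_left_mono add_nonneg_nonneg sum_nonneg) auto
  also have "\<dots> \<le> 2 * (q z)\<^sup>2 + 2 * ((\<Sum>m<N. q m) / real b)\<^sup>2"
    using zero_le_power2[of "q z - (\<Sum>m<N. q m) / real b"]
    by (simp add: power2_eq_square algebra_simps)
  \<comment> \<open>Only the square at \<open>z\<close> occurs, but which participation is the
    latest changes from row to row; the sum over all of \<open>A\<close> can later be regrouped by
    columns.\<close>
  also have "(q z)\<^sup>2 \<le> (\<Sum>a\<in>A. (q a)\<^sup>2)"
    by (rule member_le_sum) (use fin z in auto)
  finally show ?thesis by simp
qed simp

text \<open>In a fixed row the participating entries are \<open>q\<close> at the lags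
  \<open>r - i\<close>, again \<open>b\<close>-separated, so \<open>separated_sum_le\<close>
  applies. Summed over rows, the squares give at most \<open>k\<close> column norms, and the window
  term is paid \<open>n\<close> times.\<close>

lemma sens_toeplitz_le:
  fixes q :: "nat \<Rightarrow> real"
  assumes q: "antimono q" "\<And>m. 0 \<le> q m" and b: "1 \<le> b"
  shows "sens k b d (lower_toeplitz n q)
    \<le> sqrt (2 * real k * (\<Sum>m<n. (q m)\<^sup>2) + 2 * real n * ((\<Sum>m<n. q m) / real b)\<^sup>2)"
proof (rule sens_leI)
  let ?C = "lower_toeplitz n q"
  have dims: "dim_row ?C = n" "dim_col ?C = n" by (simp_all add: lower_toeplitz_def)
  fix \<pi> assume "\<pi> \<in> participations (dim_col ?C) k b"
  then have sub: "\<pi> \<subseteq> {..<n}" and card: "card \<pi> \<le> k"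
    and sep: "\<And>i j. i \<in> \<pi> \<Longrightarrow> j \<in> \<pi> \<Longrightarrow> i \<noteq> j \<Longrightarrow> int b \<le> \<bar>int i - int j\<bar>"
    by (auto simp: participations_def dims)
  have fin: "finite \<pi>" using sub finite_subset by blast
  let ?S = "2 * ((\<Sum>m<n. q m) / real b)\<^sup>2"
  have row: "(\<Sum>i\<in>\<pi>. \<bar>?C $$ (r, i)\<bar>)\<^sup>2
      \<le> 2 * (\<Sum>i\<in>\<pi>. if i \<le> r then (q (r - i))\<^sup>2 else 0) + ?S" if r: "r < n" for r
  proof -
    let ?I = "{i\<in>\<pi>. i \<le> r}"
    let ?A = "(\<lambda>i. r - i) ` ?I"
    have inj: "inj_on (\<lambda>i. r - i) ?I" by (auto simp: inj_on_def)
    have "(\<Sum>i\<in>\<pi>. \<bar>?C $$ (r, i)\<bar>) = (\<Sum>i\<in>\<pi>. if i \<le> r then q (r - i) else 0)"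
      using r sub q(2) by (intro sum.cong) (auto simp: lower_toeplitz_def)
    also have "\<dots> = (\<Sum>i\<in>?I. q (r - i))"
      by (rule sum.inter_filter[OF fin, symmetric])
    also have "\<dots> = (\<Sum>a\<in>?A. q a)" by (simp add: sum.reindex[OF inj])
    also have "\<dots>\<^sup>2 \<le> 2 * (\<Sum>a\<in>?A. (q a)\<^sup>2) + ?S"
    proof (rule separated_sum_le[OF q b])
      fix x y assume "x \<in> ?A" "y \<in> ?A" "x < y"
      then obtain i j where "i \<in> \<pi>" "j \<in> \<pi>" "i \<le> r" "j \<le> r" "x = r - i" "y = r - j" "j < i"
        by auto
      with sep[of i j] show "x + b \<le> y" by auto
    qed (use r in auto)
    also have "(\<Sum>a\<in>?A. (q a)\<^sup>2) = (\<Sum>i\<in>?I. (q (r - i))\<^sup>2)" by (simp add: sum.reindex[OF inj])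
    also have "\<dots> = (\<Sum>i\<in>\<pi>. if i \<le> r then (q (r - i))\<^sup>2 else 0)"
      by (rule sum.inter_filter[OF fin])
    finally show ?thesis .
  qed
  have "(\<Sum>r<dim_row ?C. (\<Sum>i\<in>\<pi>. \<bar>?C $$ (r, i)\<bar>)\<^sup>2)
      \<le> (\<Sum>r<n. 2 * (\<Sum>i\<in>\<pi>. if i \<le> r then (q (r - i))\<^sup>2 else 0) + ?S)"
    unfolding dims by (intro sum_mono row) auto
  also have "\<dots> = 2 * (\<Sum>r<n. \<Sum>i\<in>\<pi>. if i \<le> r then (q (r - i))\<^sup>2 else 0) + real n * ?S"
    by (simp add: sum.distrib sum_distrib_left)
  also have "(\<Sum>r<n. \<Sum>i\<in>\<pi>. if i \<le> r then (q (r - i))\<^sup>2 else 0)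
      = (\<Sum>i\<in>\<pi>. \<Sum>r<n. if i \<le> r then (q (r - i))\<^sup>2 else 0)" by (rule sum.swap)
  also have "\<dots> \<le> (\<Sum>i\<in>\<pi>. \<Sum>m<n. (q m)\<^sup>2)"
  proof (rule sum_mono)
    fix i assume "i \<in> \<pi>"
    have "(\<Sum>r<n. if i \<le> r then (q (r - i))\<^sup>2 else 0) = (\<Sum>r\<in>{i..<n}. (q (r - i))\<^sup>2)"
      by (rule sum.mono_neutral_cong_right) auto
    also have "\<dots> = (\<Sum>m<n - i. (q m)\<^sup>2)"
      by (rule sum.reindex_bij_witness[of _ "\<lambda>m. m + i" "\<lambda>r. r - i"]) auto
    also have "\<dots> \<le> (\<Sum>m<n. (q m)\<^sup>2)" by (rule sum_mono2) auto
    finally show "(\<Sum>r<n. if i \<le> r then (q (r - i))\<^sup>2 else 0) \<le> (\<Sum>m<n. (q m)\<^sup>2)" .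
  qed
  also have "\<dots> \<le> real k * (\<Sum>m<n. (q m)\<^sup>2)"
    using card by (simp add: mult_right_mono sum_nonneg)
  finally show "(\<Sum>r<dim_row ?C. (\<Sum>i\<in>\<pi>. \<bar>?C $$ (r, i)\<bar>)\<^sup>2)
      \<le> 2 * real k * (\<Sum>m<n. (q m)\<^sup>2) + 2 * real n * ((\<Sum>m<n. q m) / real b)\<^sup>2"
    by simp
qed

text \<open>With \<open>b\<close> the separation, \<open>n / b \<le> k\<close> turns
  \<open>n * (S / b)^2\<close> into \<open>k * S^2 / b\<close>.\<close>

lemma sens_separation_le:
  fixes q :: "nat \<Rightarrow> real"
  assumes kn: "1 \<le> k" "k \<le> n" and q: "antimono q" "\<And>m. 0 \<le> q m"
    and Q: "(\<Sum>m<n. (q m)\<^sup>2) \<le> Q" and S: "(\<Sum>m<n. q m) \<le> S"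
  shows "sens k (separation n k) d (lower_toeplitz n q)
    \<le> sqrt (2 * real k * (Q + S\<^sup>2 / real (separation n k)))"
proof -
  let ?b = "separation n k"
  note b = separation_bounds[OF kn]
  have b0: "real ?b > 0" using b(1) by simp
  have "real n / real ?b \<le> real k"
    using b(4) b0 by (simp add: field_simps flip: of_nat_mult)
  then have "real n / real ?b * (S\<^sup>2 / real ?b) \<le> real k * (S\<^sup>2 / real ?b)"
    using b0 by (intro mult_right_mono) auto
  moreover have "((\<Sum>m<n. q m) / real ?b)\<^sup>2 \<le> (S / real ?b)\<^sup>2"
    by (intro power_mono divide_right_mono S divide_nonneg_nonneg sum_nonneg q) auto
  then have "real n * ((\<Sum>m<n. q m) / real ?b)\<^sup>2 \<le> real n * (S / real ?b)\<^sup>2"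
    by (intro mult_left_mono) auto
  moreover have "real n * (S / real ?b)\<^sup>2 = real n / real ?b * (S\<^sup>2 / real ?b)"
    by (simp add: power2_eq_square)
  ultimately have "real n * ((\<Sum>m<n. q m) / real ?b)\<^sup>2 \<le> real k * (S\<^sup>2 / real ?b)" by linarith
  moreover have "real k * (\<Sum>m<n. (q m)\<^sup>2) \<le> real k * Q"
    by (intro mult_left_mono Q) auto
  ultimately have "2 * real k * (\<Sum>m<n. (q m)\<^sup>2) + 2 * real n * ((\<Sum>m<n. q m) / real ?b)\<^sup>2
      \<le> 2 * real k * (Q + S\<^sup>2 / real ?b)"
    unfolding distrib_left by linarith
  with sens_toeplitz_le[OF q b(1), of k d n] show ?thesis
    by (meson order_trans real_sqrt_le_iff)
qed

section \<open>Lower bounds for the sensitivity from equally spaced participations\<close>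

lemma card_multiples_below:
  assumes "1 \<le> b"
  shows "finite {l. l * b < x}" "real x / real b \<le> real (card {l. l * b < x})"
proof -
  \<comment> \<open>The rounded-up quotient of \<open>x\<close> by \<open>b\<close>, since the
    multiple 0 is counted and \<open>x\<close> itself is not.\<close>
  define m where "m = (x + b - 1) div b"
  have eq: "{l. l * b < x} = {..<m}"
  proof (rule Set.set_eqI)
    fix l
    have "l < m \<longleftrightarrow> Suc l \<le> m" by auto
    also have "\<dots> \<longleftrightarrow> Suc l * b \<le> x + b - 1"
      using assms by (simp add: m_def less_eq_div_iff_mult_less_eq del: mult_Suc)
    also have "\<dots> \<longleftrightarrow> l * b < x" using assms by auto
    finally show "l \<in> {l. l * b < x} \<longleftrightarrow> l \<in> {..<m}" by simp
  qed
  have "\<not> m * b < x" using eq by blast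
  then have "real x \<le> real m * real b" by (simp flip: of_nat_mult)
  then show "real x / real b \<le> real (card {l. l * b < x})"
    using assms by (simp add: eq field_simps)
  show "finite {l. l * b < x}" by (simp add: eq)
qed

text \<open>The densest pattern allowed by the separation; \<open>n \<le> b * k\<close> is what
  keeps it within \<open>k\<close> participations.\<close>

lemma multiples_participation:
  assumes "1 \<le> b" "n \<le> b * k"
  shows "(\<lambda>l. l * b) ` {l. l * b < n} \<in> participations n k b"
proof -
  have "{l. l * b < n} \<subseteq> {..<k}"
  proof
    fix l assume "l \<in> {l. l * b < n}"
    then have "l * b < n" by simp
    also have "n \<le> k * b" using assms(2) by (simp add: mult.commute)
    finally show "l \<in> {..<k}" by simp
  qed
  then have "card {l. l * b < n} \<le> k" using card_mono[of "{..<k}"] by fastforce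
  moreover have "int b \<le> \<bar>int (l * b) - int (l' * b)\<bar>" if "l * b \<noteq> l' * b" for l l'
  proof -
    have "l \<noteq> l'" using that by auto
    then have "1 \<le> \<bar>int l - int l'\<bar>" by linarith
    then have "1 * int b \<le> \<bar>int l - int l'\<bar> * int b" by (rule mult_right_mono) simp
    then show ?thesis by (simp add: abs_mult flip: left_diff_distrib)
  qed
  ultimately show ?thesis
    using card_image_le[OF card_multiples_below(1)[OF assms(1)], of "\<lambda>l. l * b" n]
    by (auto simp: participations_def)
qed

lemma sens_toeplitz_ge:
  fixes q :: "nat \<Rightarrow> real"
  assumes kn: "1 \<le> k" "k \<le> n" and d: "1 \<le> d"
    and M: "M \<le> (\<Sum>r<n. (\<Sum>l | l * separation n k \<le> r. q (r - l * separation n k))\<^sup>2)"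
  shows "sqrt M \<le> sens k (separation n k) d (lower_toeplitz n q)"
proof -
  let ?b = "separation n k" and ?C = "lower_toeplitz n q"
  note b = separation_bounds[OF kn]
  let ?L = "{l. l * ?b < n}"
  have dims: "dim_row ?C = n" "dim_col ?C = n" by (simp_all add: lower_toeplitz_def)
  have inj: "inj_on (\<lambda>l. l * ?b) ?L" using b(1) by (auto simp: inj_on_def)
  have row: "(\<Sum>i\<in>(\<lambda>l. l * ?b) ` ?L. ?C $$ (r, i)) = (\<Sum>l | l * ?b \<le> r. q (r - l * ?b))"
    if r: "r < n" for r
  proof -
    have "(\<Sum>i\<in>(\<lambda>l. l * ?b) ` ?L. ?C $$ (r, i)) = (\<Sum>l\<in>?L. ?C $$ (r, l * ?b))"
      by (simp add: sum.reindex[OF inj])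
    also have "\<dots> = (\<Sum>l | l * ?b \<le> r. q (r - l * ?b))"
      by (rule sum.mono_neutral_cong_right)
        (use r card_multiples_below[OF b(1)] in \<open>auto simp: lower_toeplitz_def\<close>)
    finally show ?thesis .
  qed
  show ?thesis
  proof (rule sens_geI[OF _ d])
    show "(\<lambda>l. l * ?b) ` ?L \<in> participations (dim_col ?C) k ?b"
      using multiples_participation[OF b(1,4)] by (simp add: dims)
    show "M \<le> (\<Sum>r<dim_row ?C. (\<Sum>i\<in>(\<lambda>l. l * ?b) ` ?L. ?C $$ (r, i))\<^sup>2)"
      using M by (simp add: dims row)
  qed
qed

section \<open>Log-convex sequences and banded inverses\<close>

text \<open>Solve the convolution identity at \<open>N + 1\<close> for the new coefficient and
  subtract \<open>?\<theta> N\<close> times the vanishing identity at \<open>N\<close>. The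
  remaining terms are \<open>?D j * ?W (N - j) * (?\<theta> (N - j) - ?\<theta> N)\<close>: zero for
  \<open>j = 0\<close>, and otherwise a product of two nonpositive factors.\<close>

lemma kaluza:
  fixes W :: "real fps"
  assumes W0: "fps_nth W 0 = 1" and pos: "\<And>m. 0 < fps_nth W m"
    and ratio: "incseq (\<lambda>m. fps_nth W (Suc m) / fps_nth W m)" and m: "1 \<le> m"
  shows "fps_nth (inverse W) m \<le> 0"
proof -
  let ?D = "fps_nth (inverse W)" and ?W = "fps_nth W"
  let ?\<theta> = "\<lambda>m. ?W (Suc m) / ?W m"
  have conv: "(\<Sum>j\<le>N. ?D j * ?W (N - j)) = (if N = 0 then 1 else 0)" for N
  proof -
    have "fps_nth (inverse W * W) N = (if N = 0 then 1 else 0)"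
      using W0 by (simp add: inverse_mult_eq_1)
    then show ?thesis by (simp add: fps_mult_nth atLeast0AtMost)
  qed
  show ?thesis using m
  proof (induction m rule: less_induct)
    case (less m)
    then obtain N where N: "m = Suc N" by (cases m) auto
    have "0 \<le> (\<Sum>j\<le>N. ?D j * ?W (Suc N - j))"
    proof (cases "N = 0")
      case True
      then show ?thesis using pos[of 1] W0 by simp
    next
      case False
      have "0 \<le> (\<Sum>j\<le>N. ?D j * ?W (N - j) * (?\<theta> (N - j) - ?\<theta> N))"
      proof (rule sum_nonneg)
        fix j assume "j \<in> {..N}"
        show "0 \<le> ?D j * ?W (N - j) * (?\<theta> (N - j) - ?\<theta> N)"
        proof (cases "j = 0")
          case False
          then have "?D j * ?W (N - j) \<le> 0"
            using less.IH[of j] \<open>j \<in> {..N}\<close> N pos[of "N - j"] by (intro mult_nonpos_nonneg) auto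
          moreover have "?\<theta> (N - j) - ?\<theta> N \<le> 0" using incseqD[OF ratio, of "N - j" N] by simp
          ultimately show ?thesis by (rule mult_nonpos_nonpos)
        qed simp
      qed
      also have "\<dots> = (\<Sum>j\<le>N. ?D j * ?W (N - j) * ?\<theta> (N - j)) - (\<Sum>j\<le>N. ?D j * ?W (N - j)) * ?\<theta> N"
        unfolding right_diff_distrib sum_subtractf sum_distrib_right ..
      also have "\<dots> = (\<Sum>j\<le>N. ?D j * ?W (N - j) * ?\<theta> (N - j))"
        using conv[of N] False by simp
      also have "\<dots> = (\<Sum>j\<le>N. ?D j * ?W (Suc N - j))"
      proof (rule sum.cong[OF refl])
        fix j assume "j \<in> {..N}"
        then show "?D j * ?W (N - j) * ?\<theta> (N - j) = ?D j * ?W (Suc N - j)"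
          using pos[of "N - j"] by (simp add: Suc_diff_le)
      qed
      finally show ?thesis .
    qed
    moreover have "(\<Sum>j\<le>N. ?D j * ?W (Suc N - j)) + ?D (Suc N) = 0"
      using conv[of "Suc N"] W0 by simp
    ultimately show ?case using N by simp
  qed
qed

text \<open>The coefficient of \<open>q * W\<close> at \<open>N - 1\<close> equals 1 and is at least
  \<open>c\<close> times the sum of the \<open>q\<close> involved.\<close>

lemma convolution_ones_sum_le:
  fixes q W :: "real fps"
  assumes conv: "q * W = ones" and q: "\<And>m. 0 \<le> fps_nth q m"
    and W: "\<And>m. m < N \<Longrightarrow> c \<le> fps_nth W m" and c: "0 < c"
  shows "(\<Sum>m<N. fps_nth q m) \<le> 1 / c"
proof (cases N)
  case (Suc M)
  have "c * (\<Sum>j\<le>M. fps_nth q j) \<le> (\<Sum>j\<le>M. fps_nth q j * fps_nth W (M - j))"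
    unfolding sum_distrib_left using q W Suc
    by (intro sum_mono) (metis diff_le_self less_Suc_eq_le mult.commute mult_left_mono)
  also have "\<dots> = fps_nth (q * W) M"
    by (simp add: fps_mult_nth atLeast0AtMost)
  finally show ?thesis
    using conv c Suc by (simp add: lessThan_Suc_atMost field_simps)
qed (use c in simp)

text \<open>The increments of \<open>ones * inverse W\<close> are the coefficients of
  \<open>inverse W\<close>, nonpositive after the first. For the sign, replace
  \<open>W (m - j)\<close> by the smaller \<open>W m\<close> in the vanishing convolution: the terms
  with \<open>j > 0\<close> can only grow and the term \<open>j = 0\<close> already has
  \<open>W m\<close>.\<close>

lemma log_convex_quotient:
  fixes W :: "real fps"
  assumes W0: "fps_nth W 0 = 1" and pos: "\<And>m. 0 < fps_nth W m"
    and ratio: "incseq (\<lambda>m. fps_nth W (Suc m) / fps_nth W m)" and dec: "antimono (fps_nth W)"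
  shows "antimono (fps_nth (ones * inverse W))" "0 \<le> fps_nth (ones * inverse W) m"
proof -
  let ?D = "fps_nth (inverse W)" and ?W = "fps_nth W"
  note D = kaluza[OF W0 pos ratio]
  show "antimono (fps_nth (ones * inverse W))"
    by (rule decseq_SucI) (use D in \<open>simp add: ones_mult_nth\<close>)
  show "0 \<le> fps_nth (ones * inverse W) m"
  proof (cases "m = 0")
    case False
    have "0 = (\<Sum>j\<le>m. ?D j * ?W (m - j))"
    proof -
      have "fps_nth (inverse W * W) m = 0" using W0 False by (simp add: inverse_mult_eq_1)
      then show ?thesis by (simp add: fps_mult_nth atLeast0AtMost)
    qed
    also have "\<dots> \<le> (\<Sum>j\<le>m. ?D j * ?W m)"
    proof (rule sum_mono)
      fix j assume "j \<in> {..m}"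
      show "?D j * ?W (m - j) \<le> ?D j * ?W m"
        using D[of j] antimonoD[OF dec, of "m - j" m]
        by (cases "j = 0") (auto intro: mult_left_mono_neg)
    qed
    also have "\<dots> = ?W m * fps_nth (ones * inverse W) m"
      by (simp add: ones_mult_nth sum_distrib_left mult.commute)
    finally show ?thesis using pos[of m] by (simp add: zero_le_mult_iff)
  qed (simp add: ones_mult_nth W0)
qed

text \<open>
  Truncating \<open>inverse f\<close> freezes the sequence \<open>V\<close> of its partial sums from index \<open>p - 1\<close> on,
  which preserves log-convexity.
\<close>

lemma banded_inverse_coeffs:
  fixes f V :: "real fps"
  assumes f0: "fps_nth f 0 = 1" and V: "f * V = ones" and pos: "\<And>m. 0 < fps_nth V m"
    and ratio: "\<And>m. (fps_nth V (Suc m))\<^sup>2 \<le> fps_nth V m * fps_nth V (Suc (Suc m))"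
    and dec: "antimono (fps_nth V)" and p: "1 \<le> p"
  defines "q \<equiv> inverse (fps_cutoff p (inverse f))"
  shows "fps_nth q 0 = 1" "fps_nth (ones * inverse q) j = fps_nth V (min j (p - 1))"
    "antimono (fps_nth q)" "\<And>m. 0 \<le> fps_nth q m" "\<And>m. m < p \<Longrightarrow> fps_nth q m = fps_nth f m"
    "(\<Sum>m<N. fps_nth q m) \<le> 1 / fps_nth V (p - 1)"
    "(\<Sum>m<N. (fps_nth q m)\<^sup>2)
      \<le> (\<Sum>m<p. (fps_nth f m)\<^sup>2) + fps_nth f (p - 1) / fps_nth V (p - 1)"
proof -
  define g where "g = fps_cutoff p (inverse f)"
  define W where "W = ones * g"
  have g0: "fps_nth g 0 = 1" using p f0 by (simp add: g_def)
  have q0: "fps_nth q 0 = 1" using g0 by (simp add: q_def flip: g_def)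
  then show "fps_nth q 0 = 1" .
  have qg: "q * g = 1" using g0 by (simp add: q_def inverse_mult_eq_1 flip: g_def)
  have invq: "inverse q = g" using g0 by (simp add: q_def flip: g_def)
  have V': "V = ones * inverse f"
  proof -
    have "V = inverse f * f * V" using f0 by (simp add: inverse_mult_eq_1)
    then show ?thesis using V by (simp add: mult.assoc mult.commute[of ones])
  qed
  have W: "fps_nth W j = fps_nth V (min j (p - 1))" for j
  proof -
    have "fps_nth W j = (\<Sum>i\<le>j. if i < p then fps_nth (inverse f) i else 0)"
      by (simp add: W_def g_def ones_mult_nth)
    also have "\<dots> = (\<Sum>i\<le>min j (p - 1). fps_nth (inverse f) i)"
      by (rule sum.mono_neutral_cong_right) (use p in auto)
    finally show ?thesis by (simp add: V' ones_mult_nth)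
  qed
  then show "fps_nth (ones * inverse q) j = fps_nth V (min j (p - 1))"
    by (simp add: invq W_def)
  have qW: "q * W = ones"
    using qg by (simp add: W_def mult.left_commute)
  have W0: "fps_nth W 0 = 1" using g0 by (simp add: W_def ones_mult_nth)
  have Wpos: "0 < fps_nth W m" for m using pos by (simp add: W)
  have Wdec: "antimono (fps_nth W)"
    by (rule antimonoI) (simp add: W antimonoD[OF dec] min.coboundedI1 min.mono)
  have Wratio: "incseq (\<lambda>m. fps_nth W (Suc m) / fps_nth W m)"
  proof (rule incseq_SucI)
    fix m
    have "(fps_nth W (Suc m))\<^sup>2 \<le> fps_nth W m * fps_nth W (Suc (Suc m))"
    proof -
      consider "Suc (Suc m) \<le> p - 1" | "Suc m \<ge> p - 1" by linarith
      then show ?thesis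
      proof cases
        case 1
        then show ?thesis using ratio[of m] by (simp add: W)
      next
        case 2
        then show ?thesis using antimonoD[OF dec, of "min m (p - 1)" "p - 1"] pos[of "p - 1"]
          by (simp add: W power2_eq_square min_absorb2 mult_right_mono)
      qed
    qed
    then show "fps_nth W (Suc m) / fps_nth W m \<le> fps_nth W (Suc (Suc m)) / fps_nth W (Suc m)"
      using Wpos[of m] Wpos[of "Suc m"] by (simp add: field_simps power2_eq_square)
  qed
  have q: "q = ones * inverse W"
  proof -
    have "q = q * (W * inverse W)" using W0 by (simp add: inverse_mult_eq_1')
    then show ?thesis using qW by (simp flip: mult.assoc)
  qed
  note lcq = log_convex_quotient[OF W0 Wpos Wratio Wdec, folded q]
  show anti: "antimono (fps_nth q)" and nonneg: "\<And>m. 0 \<le> fps_nth q m" by fact+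
  \<comment> \<open>Below \<open>p\<close>, multiplying by the truncated \<open>inverse f\<close>
    has the same coefficients as multiplying by \<open>inverse f\<close>.\<close>
  show qf: "fps_nth q m = fps_nth f m" if "m < p" for m
  proof -
    have "fps_nth f m = fps_nth (f * q * fps_cutoff p (inverse f)) m"
      using qg by (simp add: mult.assoc g_def)
    also have "\<dots> = fps_nth (f * q * inverse f) m"
      by (rule fps_cutoff_right_mult_nth[OF that])
    also have "f * q * inverse f = q * (f * inverse f)" by (simp add: mult_ac)
    also have "\<dots> = q" using f0 by (simp add: inverse_mult_eq_1')
    finally show ?thesis by simp
  qed
  show S: "(\<Sum>m<N. fps_nth q m) \<le> 1 / fps_nth V (p - 1)" for N
    by (rule convolution_ones_sum_le[OF qW nonneg]) (auto simp: W pos intro: antimonoD[OF dec])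
  have qp: "fps_nth q (p - 1) = fps_nth f (p - 1)" using p by (intro qf) auto
  have "(\<Sum>m<N. (fps_nth q m)\<^sup>2)
      \<le> (\<Sum>m\<in>{..<p} \<union> {p..<N}. (fps_nth q m)\<^sup>2)"
    by (rule sum_mono2) auto
  also have "\<dots> = (\<Sum>m<p. (fps_nth q m)\<^sup>2) + (\<Sum>m=p..<N. (fps_nth q m)\<^sup>2)"
    by (rule sum.union_disjoint) auto
  also have "(\<Sum>m<p. (fps_nth q m)\<^sup>2) = (\<Sum>m<p. (fps_nth f m)\<^sup>2)"
    by (simp add: qf)
  \<comment> \<open>Beyond the band one factor of each square is bounded by the last explicit
    coefficient, and the other is absorbed by the bound on the total sum.\<close>
  also have "(\<Sum>m=p..<N. (fps_nth q m)\<^sup>2) \<le> (\<Sum>m=p..<N. fps_nth f (p - 1) * fps_nth q m)"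
    unfolding power2_eq_square
    unfolding qp[symmetric] by (intro sum_mono mult_right_mono nonneg antimonoD[OF anti]) auto
  also have "\<dots> = fps_nth f (p - 1) * (\<Sum>m=p..<N. fps_nth q m)"
    by (simp add: sum_distrib_left)
  also have "\<dots> \<le> fps_nth f (p - 1) * (1 / fps_nth V (p - 1))"
  proof (rule mult_left_mono)
    have "(\<Sum>m=p..<N. fps_nth q m) \<le> (\<Sum>m<N. fps_nth q m)"
      by (rule sum_mono2) (auto intro: nonneg)
    then show "(\<Sum>m=p..<N. fps_nth q m) \<le> 1 / fps_nth V (p - 1)"
      using S[of N] by (rule order_trans)
  qed (use nonneg[of "p - 1"] qp in simp)
  finally show "(\<Sum>m<N. (fps_nth q m)\<^sup>2)
      \<le> (\<Sum>m<p. (fps_nth f m)\<^sup>2) + fps_nth f (p - 1) / fps_nth V (p - 1)"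
    by simp
qed

section \<open>The coefficients of the inverse square root\<close>

text \<open>The coefficients of \<open>(1 - x)^(-1/2)\<close>, that is
  \<open>(2m choose m) / 4^m\<close>.\<close>

definition sqrt_coeff :: "nat \<Rightarrow> real" where
  "sqrt_coeff m = \<bar>(- 1 / 2 :: real) gchoose m\<bar>"

lemma sqrt_coeff_0 [simp]: "sqrt_coeff 0 = 1"
  by (simp add: sqrt_coeff_def)

lemma sqrt_coeff_Suc: "sqrt_coeff (Suc m) = sqrt_coeff m * (1 - 1 / 2 / real (Suc m))"
proof -
  have "real (Suc m) * ((- 1 / 2) gchoose Suc m) = - (1 / 2 + real m) * ((- 1 / 2) gchoose m)"
    using gbinomial_mult_1[of "- 1 / 2 :: real" m] by (simp add: algebra_simps)
  then have "((- 1 / 2) gchoose Suc m) = - ((1 / 2 + real m) / real (Suc m)) * ((- 1 / 2) gchoose m)"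
    by (simp add: field_simps)
  then have "sqrt_coeff (Suc m) = (1 / 2 + real m) / real (Suc m) * sqrt_coeff m"
    by (simp add: sqrt_coeff_def abs_mult)
  also have "(1 / 2 + real m) / real (Suc m) = 1 - 1 / 2 / real (Suc m)"
    by (simp add: field_simps)
  finally show ?thesis by simp
qed

lemma sqrt_coeff_pos: "0 < sqrt_coeff m"
proof (induction m)
  case (Suc m)
  have "0 < 1 - 1 / 2 / real (Suc m)" by (simp add: field_simps)
  with Suc show ?case unfolding sqrt_coeff_Suc by (rule mult_pos_pos)
qed simp

lemma sqrt_coeff_antimono: "antimono sqrt_coeff"
  by (rule decseq_SucI) (auto simp: sqrt_coeff_Suc intro!: mult_left_le less_imp_le[OF sqrt_coeff_pos])

text \<open>The consecutive ratios \<open>1 - 1 / (2 (m + 1))\<close> increase.\<close>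

lemma sqrt_coeff_log_convex:
  "(sqrt_coeff (Suc m))\<^sup>2 \<le> sqrt_coeff m * sqrt_coeff (Suc (Suc m))"
proof -
  have "1 - 1 / 2 / real (Suc m) \<le> 1 - 1 / 2 / real (Suc (Suc m))"
    by (simp add: field_simps)
  then have "sqrt_coeff (Suc m) * (sqrt_coeff m * (1 - 1 / 2 / real (Suc m)))
      \<le> sqrt_coeff (Suc m) * (sqrt_coeff m * (1 - 1 / 2 / real (Suc (Suc m))))"
    by (intro mult_left_mono less_imp_le[OF sqrt_coeff_pos])
  then show ?thesis
    unfolding sqrt_coeff_Suc[symmetric] by (simp add: sqrt_coeff_Suc[of "Suc m"] power2_eq_square mult_ac)
qed

lemma sqrt_coeff_upper: "(sqrt_coeff m)\<^sup>2 \<le> 1 / real (m + 1)"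
proof (induction m)
  case (Suc m)
  have "(sqrt_coeff (Suc m))\<^sup>2 \<le> 1 / real (m + 1) * (1 - 1 / 2 / real (Suc m))\<^sup>2"
    unfolding sqrt_coeff_Suc power_mult_distrib by (rule mult_right_mono[OF Suc]) simp
  also have "\<dots> \<le> 1 / real (Suc m + 1)"
  proof -
    have "1 / real (m + 1) * (1 - 1 / 2 / real (Suc m))\<^sup>2 = (2 * real m + 1)\<^sup>2 / (4 * (real m + 1) ^ 3)"
      by (simp add: field_simps power2_eq_square power3_eq_cube)
    also have "\<dots> \<le> 1 / (real m + 2)"
      by (simp add: divide_simps) (simp add: power2_eq_square power3_eq_cube algebra_simps)
    finally show ?thesis by (simp add: add.commute)
  qed
  finally show ?case .
qed simp

text \<open>The form \<open>4 m + 1\<close> is exact at 0 and closes the induction barely: after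
  clearing denominators the two sides of the step differ by exactly 1.\<close>

lemma sqrt_coeff_lower: "1 / (4 * real m + 1) \<le> (sqrt_coeff m)\<^sup>2"
proof (induction m)
  case (Suc m)
  have "1 / (4 * real (Suc m) + 1) \<le> 1 / (4 * real m + 1) * (1 - 1 / 2 / real (Suc m))\<^sup>2"
  proof -
    have eq: "1 / (4 * real m + 1) * (1 - 1 / 2 / real (Suc m))\<^sup>2
        = (2 * real m + 1)\<^sup>2 / ((4 * real m + 1) * (4 * (real m + 1)\<^sup>2))"
      by (simp add: field_simps power2_eq_square)
    have "1 / (4 * real m + 5) \<le> (2 * real m + 1)\<^sup>2 / ((4 * real m + 1) * (4 * (real m + 1)\<^sup>2))"
      by (simp add: divide_simps) (simp add: power2_eq_square algebra_simps)
    then show ?thesis unfolding eq by (simp add: add.commute)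
  qed
  also have "\<dots> \<le> (sqrt_coeff (Suc m))\<^sup>2"
    unfolding sqrt_coeff_Suc power_mult_distrib by (rule mult_right_mono[OF Suc]) simp
  finally show ?case .
qed simp

lemma sqrt_coeff_ge: "1 / (2 * sqrt (real (m + 1))) \<le> sqrt_coeff m"
proof (rule power2_le_imp_le)
  have "(1 / (2 * sqrt (real (m + 1))))\<^sup>2 = 1 / (4 * real m + 4)"
    by (simp add: power_divide power_mult_distrib algebra_simps)
  also have "\<dots> \<le> 1 / (4 * real m + 1)" by (simp add: divide_simps)
  also note sqrt_coeff_lower[of m]
  finally show "(1 / (2 * sqrt (real (m + 1))))\<^sup>2 \<le> (sqrt_coeff m)\<^sup>2" .
qed (rule less_imp_le[OF sqrt_coeff_pos])

lemma prefix_sqrt_toep: "prefix_sqrt n = toep n (Abs_fps sqrt_coeff)"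
  by (rule eq_matI) (auto simp: prefix_sqrt_def lower_toeplitz_def sqrt_coeff_def)

text \<open>Coefficient \<open>N\<close> of the square is the bottom left entry of the matrix
  identity \<open>prefix_sqrt_square\<close> in size \<open>N + 1\<close>.\<close>

lemma sqrt_coeff_square: "Abs_fps sqrt_coeff * Abs_fps sqrt_coeff = ones"
proof (rule fps_ext)
  fix N
  have "toep (Suc N) (Abs_fps sqrt_coeff * Abs_fps sqrt_coeff) = prefix_sum (Suc N)"
    using prefix_sqrt_square[of "Suc N"] by (simp add: prefix_sqrt_toep toep_mult)
  then have "toep (Suc N) (Abs_fps sqrt_coeff * Abs_fps sqrt_coeff) $$ (N, 0)
      = prefix_sum (Suc N) $$ (N, 0)" by simp
  then show "fps_nth (Abs_fps sqrt_coeff * Abs_fps sqrt_coeff) N = fps_nth ones N"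
    by (simp add: prefix_sum_def lower_toeplitz_def)
qed

section \<open>The reciprocal of the logarithm\<close>

text \<open>The rising factorial of \<open>1 - s\<close> divided by \<open>N!\<close>, the
  coefficient of \<open>x^N\<close> in \<open>(1 - x)^(s - 1)\<close>.\<close>

definition rising_ratio :: "nat \<Rightarrow> real \<Rightarrow> real" where
  "rising_ratio N s = (\<Prod>i=1..N. 1 - s / real i)"

lemma rising_ratio_0 [simp]: "rising_ratio 0 s = 1"
  by (simp add: rising_ratio_def)

lemma rising_ratio_Suc: "rising_ratio (Suc N) s = rising_ratio N s * (1 - s / real (Suc N))"
  by (simp add: rising_ratio_def)

lemma rising_ratio_nonneg: "s \<le> 1 \<Longrightarrow> 0 \<le> rising_ratio N s"
  unfolding rising_ratio_def by (intro prod_nonneg) (auto simp: field_simps)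

lemma rising_ratio_half: "rising_ratio N (1 / 2) = sqrt_coeff N"
  by (induction N) (simp_all add: rising_ratio_Suc sqrt_coeff_Suc)

lemma rising_ratio_mono: "s \<le> u \<Longrightarrow> u \<le> 1 \<Longrightarrow> rising_ratio N u \<le> rising_ratio N s"
  unfolding rising_ratio_def by (intro prod_mono) (auto simp: field_simps divide_right_mono)

lemma continuous_rising_ratio: "continuous_on A (rising_ratio N)"
  unfolding rising_ratio_def by (intro continuous_intros) auto

lemma integrable_rising_ratio: "rising_ratio N integrable_on {a..b}"
  by (rule integrable_continuous_real[OF continuous_rising_ratio])

text \<open>The product rule step for differentiating in \<open>s\<close>: the derivative of
  \<open>(1 - x)^(s - 1)\<close> is that series times \<open>ln (1 - x)\<close>, hence a convolution
  with reciprocals. Multiplying by \<open>N + 1 = (N + 1 - j) + j\<close> and shifting the part with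
  factor \<open>j\<close> by one index gives the recursion.\<close>

lemma rising_ratio_derivative_sum:
  "(\<Sum>j\<le>N. rising_ratio j s / real (Suc N - j))
    = (\<Sum>j<N. rising_ratio j s / real (N - j)) * (1 - s / real (Suc N)) + rising_ratio N s / real (Suc N)"
proof -
  let ?g = "\<lambda>j. rising_ratio j s"
  have "real (Suc N) * (\<Sum>j\<le>N. ?g j / real (Suc N - j))
      = (\<Sum>j\<le>N. real j * ?g j / real (Suc N - j) + ?g j)"
    unfolding sum_distrib_left
    by (intro sum.cong refl) (simp add: field_simps of_nat_diff)
  also have "\<dots> = (\<Sum>j\<le>N. real j * ?g j / real (Suc N - j)) + (\<Sum>j\<le>N. ?g j)"
    by (rule sum.distrib)
  also have "(\<Sum>j\<le>N. real j * ?g j / real (Suc N - j))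
      = (\<Sum>j<N. real (Suc j) * ?g (Suc j) / real (N - j))"
    unfolding lessThan_Suc_atMost[symmetric] sum.lessThan_Suc_shift by simp
  also have "\<dots> = (\<Sum>j<N. (real (Suc N) - s) * (?g j / real (N - j)) - ?g j)"
  proof (rule sum.cong[OF refl])
    fix j assume "j \<in> {..<N}"
    then have j: "real (N - j) = real N - real j" "real N - real j > 0" by (auto simp: of_nat_diff)
    have "real (Suc j) * ?g (Suc j) = (real (Suc j) - s) * ?g j"
      by (simp add: rising_ratio_Suc field_simps)
    also have "\<dots> = (real (Suc N) - s) * ?g j - real (N - j) * ?g j"
      unfolding j(1) by (simp add: algebra_simps)
    finally show "real (Suc j) * ?g (Suc j) / real (N - j)
        = (real (Suc N) - s) * (?g j / real (N - j)) - ?g j"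
      using j by (simp add: diff_divide_distrib)
  qed
  also have "\<dots> = (real (Suc N) - s) * (\<Sum>j<N. ?g j / real (N - j)) - (\<Sum>j<N. ?g j)"
    by (simp add: sum_subtractf sum_distrib_left)
  finally have "real (Suc N) * (\<Sum>j\<le>N. ?g j / real (Suc N - j))
      = (real (Suc N) - s) * (\<Sum>j<N. ?g j / real (N - j)) + ?g N"
    by (simp flip: lessThan_Suc_atMost)
  then have "(\<Sum>j\<le>N. ?g j / real (Suc N - j))
      = ((real (Suc N) - s) * (\<Sum>j<N. ?g j / real (N - j)) + ?g N) / real (Suc N)"
    by (simp add: field_simps del: of_nat_Suc)
  also have "\<dots> = (\<Sum>j<N. ?g j / real (N - j)) * ((real (Suc N) - s) / real (Suc N)) + ?g N / real (Suc N)"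
    by (simp add: add_divide_distrib)
  also have "(real (Suc N) - s) / real (Suc N) = 1 - s / real (Suc N)"
    by (simp add: diff_divide_distrib del: of_nat_Suc)
  finally show ?thesis .
qed

lemma rising_ratio_deriv:
  "(rising_ratio N has_real_derivative - (\<Sum>j<N. rising_ratio j s / real (N - j))) (at s within A)"
proof (induction N)
  case 0
  have "rising_ratio 0 = (\<lambda>_. 1)" by auto
  then show ?case by simp
next
  case (Suc N)
  have "(rising_ratio (Suc N) has_real_derivative
      - (\<Sum>j<N. rising_ratio j s / real (N - j)) * (1 - s / real (Suc N))
      + (- (1 / real (Suc N))) * rising_ratio N s) (at s within A)"
    unfolding rising_ratio_Suc[abs_def]
    by (rule DERIV_mult[OF Suc]) (auto intro!: derivative_eq_intros)
  then show ?case
    using rising_ratio_derivative_sum[where N = N and s = s] by (simp add: lessThan_Suc_atMost)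
qed

text \<open>
  The generating function of \<open>log_coeff\<close> is \<open>\<integral>\<^sub>0\<^sup>1 (1 - x)\<^bsup>s - 1\<^esup> ds = x / ((1 - x) ln (1 / (1 - x)))\<close>,
  and the integrand is \<open>\<Sum>N. rising_ratio N s x\<^sup>N\<close>.
\<close>

definition log_coeff :: "nat \<Rightarrow> real" where
  "log_coeff N = integral {0..1} (rising_ratio N)"

lemma log_coeff_has_integral: "(rising_ratio N has_integral log_coeff N) {0..1}"
  unfolding log_coeff_def by (rule integrable_integral[OF integrable_rising_ratio])

text \<open>The convolution at \<open>s\<close> is minus the derivative of
  \<open>rising_ratio (Suc N)\<close>, which falls from 1 at \<open>s = 0\<close> to 0 at
  \<open>s = 1\<close>; integrating gives 1.\<close>

lemma log_coeff_convolution: "(\<Sum>j\<le>N. log_coeff j / real (Suc N - j)) = 1"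
proof -
  have "((\<lambda>s. - (\<Sum>j<Suc N. rising_ratio j s / real (Suc N - j))) has_integral
      rising_ratio (Suc N) 1 - rising_ratio (Suc N) 0) {0..1}"
    by (rule fundamental_theorem_of_calculus)
      (simp, simp only: flip: has_real_derivative_iff_has_vector_derivative, rule rising_ratio_deriv)
  moreover have "rising_ratio (Suc N) 1 = 0"
    unfolding rising_ratio_def by (rule prod_zero) (auto intro!: bexI[of _ 1])
  moreover have "rising_ratio (Suc N) 0 = 1" by (simp add: rising_ratio_def)
  ultimately have "((\<lambda>s. - (\<Sum>j\<le>N. rising_ratio j s / real (Suc N - j))) has_integral - 1) {0..1}"
    by (simp only: lessThan_Suc_atMost) simp
  from has_integral_neg[OF this]
  have "((\<lambda>s. \<Sum>j\<le>N. rising_ratio j s / real (Suc N - j)) has_integral 1) {0..1}" by simp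
  moreover have "((\<lambda>s. \<Sum>j\<le>N. rising_ratio j s / real (Suc N - j)) has_integral
      (\<Sum>j\<le>N. log_coeff j / real (Suc N - j))) {0..1}"
    by (intro has_integral_sum has_integral_divide log_coeff_has_integral) auto
  ultimately show ?thesis by (rule has_integral_unique[THEN sym])
qed

lemma log_coeff_0 [simp]: "log_coeff 0 = 1"
  using log_coeff_convolution[of 0] by simp

text \<open>Only \<open>s \<le> 1 / 2\<close> is kept. This is crude, the decay being logarithmic,
  but it suffices where it is used: the bound on \<open>S\<close> becomes a multiple of
  \<open>sqrt b\<close>, and only \<open>S^2 / b\<close> has to be bounded.\<close>

lemma log_coeff_ge: "sqrt_coeff N / 2 \<le> log_coeff N"
proof -
  have "sqrt_coeff N / 2 = integral {0..1/2::real} (\<lambda>_. sqrt_coeff N)" by simp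
  also have "\<dots> \<le> integral {0..1/2::real} (rising_ratio N)"
    by (intro integral_le integrable_rising_ratio)
      (auto simp flip: rising_ratio_half intro!: rising_ratio_mono)
  also have "\<dots> \<le> integral {0..1} (rising_ratio N)"
    by (intro integral_subset_le integrable_rising_ratio) (auto intro: rising_ratio_nonneg)
  finally show ?thesis by (simp add: log_coeff_def)
qed

lemma log_coeff_pos: "0 < log_coeff N"
  using log_coeff_ge[of N] sqrt_coeff_pos[of N] by linarith

lemma log_coeff_antimono: "antimono log_coeff"
proof (rule decseq_SucI)
  fix N
  show "log_coeff (Suc N) \<le> log_coeff N"
    unfolding log_coeff_def
    by (intro integral_le integrable_rising_ratio)
      (auto simp: rising_ratio_Suc intro!: mult_left_le rising_ratio_nonneg)
qed

lemma log_coeff_log_convex: "(log_coeff (Suc N))\<^sup>2 \<le> log_coeff N * log_coeff (Suc (Suc N))"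
proof -
  let ?g = rising_ratio and ?a = "log_coeff N" and ?b = "log_coeff (Suc N)"
    and ?c = "log_coeff (Suc (Suc N))"
  \<comment> \<open>The value of \<open>l\<close> minimizing
    \<open>?a - 2 * l * ?b + l^2 * ?c\<close>; nonnegativity of this minimum is the claim, as in the
    proof of the Cauchy-Schwarz inequality.\<close>
  define l where "l = ?b / ?c"
  have c: "0 < ?c" by (rule log_coeff_pos)
  have pointwise: "0 \<le> ?g N s - 2 * l * ?g (Suc N) s + l\<^sup>2 * ?g (Suc (Suc N)) s"
    if s: "s \<in> {0..1}" for s
  proof -
    define u where "u = 1 - s / real (Suc N)"
    have u: "0 \<le> u" "u \<le> 1 - s / real (Suc (Suc N))"
      using s by (auto simp: u_def field_simps)
    have "0 \<le> (1 - l * u)\<^sup>2" by simp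
    also have "\<dots> = 1 - 2 * l * u + l\<^sup>2 * (u * u)" by (simp add: power2_eq_square algebra_simps)
    also have "\<dots> \<le> 1 - 2 * l * u + l\<^sup>2 * (u * (1 - s / real (Suc (Suc N))))"
      by (intro add_left_mono mult_left_mono u) auto
    finally have "0 \<le> ?g N s * (1 - 2 * l * u + l\<^sup>2 * (u * (1 - s / real (Suc (Suc N)))))"
      using s by (intro mult_nonneg_nonneg rising_ratio_nonneg) auto
    also have "\<dots> = ?g N s - 2 * l * ?g (Suc N) s + l\<^sup>2 * ?g (Suc (Suc N)) s"
      unfolding rising_ratio_Suc u_def[symmetric] by (simp add: algebra_simps)
    finally show ?thesis .
  qed
  have "((\<lambda>s. ?g N s - 2 * l * ?g (Suc N) s + l\<^sup>2 * ?g (Suc (Suc N)) s) has_integral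
      (?a - 2 * l * ?b + l\<^sup>2 * ?c)) {0..1}"
    by (intro has_integral_add has_integral_diff has_integral_mult_right log_coeff_has_integral)
  from has_integral_nonneg[OF this pointwise] have "0 \<le> ?a - 2 * l * ?b + l\<^sup>2 * ?c" .
  also have "\<dots> = ?a - ?b\<^sup>2 / ?c"
    using c by (simp add: l_def power2_eq_square field_simps)
  finally show ?thesis using c by (simp add: field_simps)
qed

lemma D_Toep_toep: "D_Toep n = toep n (Abs_fps (\<lambda>m. 1 / real (m + 1)))"
  by (rule eq_matI) (auto simp: D_Toep_def lower_toeplitz_def)

lemma log_coeff_inverse: "Abs_fps (\<lambda>m. 1 / real (m + 1)) * Abs_fps log_coeff = ones"
proof (rule fps_ext)
  fix N
  have "fps_nth (Abs_fps log_coeff * Abs_fps (\<lambda>m. 1 / real (m + 1))) N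
      = (\<Sum>j\<le>N. log_coeff j / real (Suc N - j))"
    by (auto simp: fps_mult_nth atLeast0AtMost Suc_diff_le intro!: sum.cong)
  then show "fps_nth (Abs_fps (\<lambda>m. 1 / real (m + 1)) * Abs_fps log_coeff) N = fps_nth ones N"
    unfolding log_coeff_convolution by (simp add: mult.commute)
qed

lemma harm_sum: "(\<Sum>m<N. 1 / real (m + 1)) = harm N"
  by (simp add: harm_altdef divide_inverse)

text \<open>In \<open>log_coeff_convolution\<close> every \<open>log_coeff j\<close> is replaced by
  the smallest one, \<open>log_coeff N\<close>.\<close>

lemma log_coeff_le_harm: "log_coeff N \<le> 1 / harm (Suc N)"
proof -
  have "log_coeff N * harm (Suc N) = (\<Sum>j\<le>N. log_coeff N / real (Suc N - j))"
  proof -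
    have "harm (Suc N) = (\<Sum>j\<le>N. 1 / real (Suc N - j))"
      unfolding harm_sum[symmetric] lessThan_Suc_atMost
      by (rule sum.reindex_bij_witness[of _ "\<lambda>j. N - j" "\<lambda>j. N - j"]) auto
    then show ?thesis by (simp add: sum_distrib_left)
  qed
  also have "\<dots> \<le> (\<Sum>j\<le>N. log_coeff j / real (Suc N - j))"
    by (intro sum_mono divide_right_mono antimonoD[OF log_coeff_antimono]) auto
  finally show ?thesis
    using log_coeff_convolution[of N] by (simp add: pos_le_divide_eq harm_pos)
qed

text \<open>The discrete form of the convergent integral of \<open>1 / (x ln^2 x)\<close>: each
  later term is at most \<open>1 / harm N - 1 / harm (Suc N)\<close>. It bounds the row factor of
  \<open>D_Toep\<close>.\<close>

lemma sum_harm_squares_le: "(\<Sum>j<N. 1 / (real (j + 1) * (harm (j + 1))\<^sup>2)) \<le> 2"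
proof -
  have "(\<Sum>j<N. 1 / (real (j + 1) * (harm (j + 1))\<^sup>2)) \<le> 2 - (if N = 0 then 0 else 1 / harm N)"
  proof (induction N)
    case (Suc N)
    show ?case
    proof (cases "N = 0")
      case False
      then have h: "(0::real) < harm N" "(0::real) < harm (Suc N)" "harm N \<le> (harm (Suc N) :: real)"
        using harm_pos[of N] harm_pos[of "Suc N"] harm_mono[of N "Suc N"] by auto
      have "1 / (real (Suc N) * (harm (Suc N))\<^sup>2) = 1 / real (Suc N) / (harm (Suc N) * harm (Suc N))"
        by (simp add: power2_eq_square)
      also have "\<dots> \<le> 1 / real (Suc N) / (harm N * harm (Suc N))"
        using h by (intro divide_left_mono mult_right_mono less_imp_le[OF h(2)]) auto
      also have "1 / real (Suc N) = harm (Suc N) - harm N"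
        by (simp add: harm_Suc divide_inverse)
      also have "(harm (Suc N) - harm N) / (harm N * harm (Suc N)) = 1 / harm N - 1 / (harm (Suc N) :: real)"
        using less_imp_neq[OF h(1), THEN not_sym] less_imp_neq[OF h(2), THEN not_sym]
        by (simp add: diff_divide_distrib)
      finally show ?thesis using Suc False by simp
    qed (simp add: harm_expand)
  qed simp
  then show ?thesis using harm_nonneg[of N, where ?'a = real]
    by (smt (verit) divide_nonneg_nonneg)
qed

lemma sum_inverse_squares_le: "(\<Sum>m<N. (1 / real (m + 1))\<^sup>2) \<le> 2"
proof -
  have "(\<Sum>m<N. (1 / real (m + 1))\<^sup>2) = (\<Sum>i=1..N. 1 / (real i)\<^sup>2)"
    by (rule sum.reindex_bij_witness[of _ "\<lambda>i. i - 1" "\<lambda>m. m + 1"]) (auto simp: power_divide)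
  with sum_inverse_squares_tail[of 1 N] show ?thesis by simp
qed

lemma harm_le: "1 \<le> N \<Longrightarrow> harm N \<le> 1 + ln (real N)"
  using decseqD[OF decseq_harm_diff_ln, of 0 "N - 1"] by (simp add: harm_expand)

section \<open>Error bounds\<close>

lemma averaging_error_toep:
  assumes "fps_nth f 0 = 1" "t \<le> n"
  shows "averaging_error n k d t (toep n f)
    = sqrt ((\<Sum>i<t. (\<Sum>j\<le>i. (fps_nth (ones * inverse f) j)\<^sup>2) / (real (i + 1))\<^sup>2) / real t)
      * sens k (separation n k) d (toep n f)"
  using frobenius_averaging_toep[OF assms(1) refl assms(2)]
  by (simp add: averaging_error_def error_at_def real_sqrt_divide)

lemma sens_toep_nonneg:
  assumes "1 \<le> k" "k \<le> n" "1 \<le> d"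
  shows "0 \<le> sens k (separation n k) d (toep n f)"
  using sens_toeplitz_ge[OF assms, of 0 "fps_nth f"] by (simp add: toep_def sum_nonneg)

text \<open>The common scheme of all upper bounds: each case supplies a majorant \<open>u\<close>,
  the row bound \<open>G\<close> and the bounds \<open>Q\<close>, \<open>S\<close>, \<open>Z\<close>
  for the sensitivity. The constants 40, 24, 288, 1984 and 176 below are the numerical parts of
  \<open>2 * G * Z\<close>.\<close>

lemma averaging_error_le:
  assumes kn: "1 \<le> k" "k \<le> n" and d: "1 \<le> d" and t: "1 \<le> t" "t \<le> n"
    and f: "fps_nth f 0 = 1" "antimono (fps_nth f)" "\<And>m. 0 \<le> fps_nth f m"
    and u: "\<And>j. j < t \<Longrightarrow> (fps_nth (ones * inverse f) j)\<^sup>2 \<le> u j"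
    and G: "2 * (\<Sum>j<t. u j / real (j + 1)) \<le> G"
    and Q: "(\<Sum>m<n. (fps_nth f m)\<^sup>2) \<le> Q" and S: "(\<Sum>m<n. fps_nth f m) \<le> S"
    and Z: "Q + S\<^sup>2 / real (separation n k) \<le> Z"
  shows "averaging_error n k d t (toep n f) \<le> sqrt (2 * G * Z * real k / real t)"
proof -
  let ?R = "\<Sum>i<t. (\<Sum>j\<le>i. (fps_nth (ones * inverse f) j)\<^sup>2) / (real (i + 1))\<^sup>2"
  have R: "?R \<le> G" using averaging_row_norms_le[of t "fps_nth (ones * inverse f)", OF u] G by linarith
  have "0 \<le> ?R" by (intro sum_nonneg divide_nonneg_nonneg) auto
  then have G0: "0 \<le> G" using R by linarith
  have "sens k (separation n k) d (toep n f) \<le> sqrt (2 * real k * (Q + S\<^sup>2 / real (separation n k)))"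
    unfolding toep_def by (rule sens_separation_le[OF kn f(2,3) Q S])
  also have "\<dots> \<le> sqrt (2 * real k * Z)" using Z by (intro real_sqrt_le_mono mult_left_mono) auto
  finally have s: "sens k (separation n k) d (toep n f) \<le> sqrt (2 * real k * Z)" .
  have "averaging_error n k d t (toep n f) \<le> sqrt (G / real t) * sqrt (2 * real k * Z)"
    unfolding averaging_error_toep[OF f(1) t(2)] using R G0 sens_toep_nonneg[OF kn d]
    by (intro mult_mono real_sqrt_le_mono divide_right_mono s) auto
  also have "\<dots> = sqrt (2 * G * Z * real k / real t)"
    unfolding real_sqrt_mult[symmetric] by (simp add: mult_ac)
  finally show ?thesis .
qed

lemma averaging_error_nonneg:
  assumes "1 \<le> k" "k \<le> n" "1 \<le> d" "t \<le> n" "fps_nth f 0 = 1"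
  shows "0 \<le> averaging_error n k d t (toep n f)"
  unfolding averaging_error_toep[OF assms(5,4)]
  by (intro mult_nonneg_nonneg sens_toep_nonneg assms(1-3) real_sqrt_ge_zero divide_nonneg_nonneg sum_nonneg) auto

lemma averaging_error_ge:
  assumes kn: "1 \<le> k" "k \<le> n" and d: "1 \<le> d" and t: "1 \<le> t" "t \<le> n"
    and f: "fps_nth f 0 = 1"
    and H: "H \<le> (\<Sum>i<t. (\<Sum>j\<le>i. (fps_nth (ones * inverse f) j)\<^sup>2) / (real (i + 1))\<^sup>2)"
    and M: "0 \<le> M"
      "M \<le> (\<Sum>r<n. (\<Sum>l | l * separation n k \<le> r. fps_nth f (r - l * separation n k))\<^sup>2)"
  shows "sqrt (H * M / real t) \<le> averaging_error n k d t (toep n f)"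
proof -
  have "sqrt (H * M / real t) = sqrt (H / real t) * sqrt M"
    by (simp flip: real_sqrt_mult)
  also have "\<dots> \<le> averaging_error n k d t (toep n f)"
    unfolding averaging_error_toep[OF f t(2)]
    by (intro mult_mono real_sqrt_le_mono divide_right_mono H
        sens_toeplitz_ge[OF kn d M(2), folded toep_def])
      (auto intro!: divide_nonneg_nonneg sum_nonneg M(1))
  finally show ?thesis .
qed

lemma sum_squares_le_square_sum:
  fixes x :: "'a \<Rightarrow> real"
  assumes "finite A" "\<And>a. a \<in> A \<Longrightarrow> 0 \<le> x a"
  shows "(\<Sum>a\<in>A. (x a)\<^sup>2) \<le> (\<Sum>a\<in>A. x a)\<^sup>2"
proof -
  have "(\<Sum>a\<in>A. (x a)\<^sup>2) \<le> (\<Sum>a\<in>A. x a * (\<Sum>a\<in>A. x a))"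
    unfolding power2_eq_square using assms
    by (intro sum_mono mult_left_mono member_le_sum) auto
  then show ?thesis by (simp add: power2_eq_square sum_distrib_right)
qed

text \<open>At least \<open>h / b\<close> participations start before \<open>h\<close>, and each
  such column still contains all \<open>q m\<close> with \<open>m \<le> n - h\<close>. By
  nonnegativity the square of a row sum dominates the sum of squares.\<close>

lemma multiples_rows_ge:
  fixes q :: "nat \<Rightarrow> real"
  assumes b: "1 \<le> b" and q: "\<And>m. 0 \<le> q m" and h: "h \<le> n"
  shows "real h / real b * (\<Sum>m\<le>n - h. (q m)\<^sup>2) \<le> (\<Sum>r<n. (\<Sum>l | l * b \<le> r. q (r - l * b))\<^sup>2)"
proof -
  let ?L = "{l. l * b < h}"
  have fin: "finite {l. l * b \<le> r}" for r
    using card_multiples_below(1)[OF b, of "Suc r"] by (simp add: less_Suc_eq_le)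
  have "real h / real b * (\<Sum>m\<le>n - h. (q m)\<^sup>2) \<le> real (card ?L) * (\<Sum>m\<le>n - h. (q m)\<^sup>2)"
    by (intro mult_right_mono card_multiples_below[OF b] sum_nonneg) auto
  also have "\<dots> = (\<Sum>l\<in>?L. \<Sum>m\<le>n - h. (q m)\<^sup>2)" by simp
  also have "\<dots> \<le> (\<Sum>l\<in>?L. \<Sum>r<n. if l * b \<le> r then (q (r - l * b))\<^sup>2 else 0)"
  proof (rule sum_mono)
    fix l assume l: "l \<in> ?L"
    have "(\<Sum>m\<le>n - h. (q m)\<^sup>2) \<le> (\<Sum>m<n - l * b. (q m)\<^sup>2)"
      by (rule sum_mono2) (use l h in auto)
    also have "\<dots> = (\<Sum>r\<in>{l * b..<n}. (q (r - l * b))\<^sup>2)"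
      by (rule sum.reindex_bij_witness[of _ "\<lambda>r. r - l * b" "\<lambda>m. m + l * b"]) auto
    also have "\<dots> = (\<Sum>r<n. if l * b \<le> r then (q (r - l * b))\<^sup>2 else 0)"
      by (rule sum.mono_neutral_cong_left) auto
    finally show "(\<Sum>m\<le>n - h. (q m)\<^sup>2) \<le> (\<Sum>r<n. if l * b \<le> r then (q (r - l * b))\<^sup>2 else 0)" .
  qed
  also have "\<dots> = (\<Sum>r<n. \<Sum>l\<in>?L. if l * b \<le> r then (q (r - l * b))\<^sup>2 else 0)"
    by (rule sum.swap)
  also have "\<dots> \<le> (\<Sum>r<n. (\<Sum>l | l * b \<le> r. q (r - l * b))\<^sup>2)"
  proof (rule sum_mono)
    fix r
    have "(\<Sum>l\<in>?L. if l * b \<le> r then (q (r - l * b))\<^sup>2 else 0)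
        = (\<Sum>l\<in>{l\<in>?L. l * b \<le> r}. (q (r - l * b))\<^sup>2)"
      by (rule sum.inter_filter[symmetric]) (rule card_multiples_below(1)[OF b])
    also have "\<dots> \<le> (\<Sum>l | l * b \<le> r. (q (r - l * b))\<^sup>2)"
      by (rule sum_mono2[OF fin]) auto
    also have "\<dots> \<le> (\<Sum>l | l * b \<le> r. q (r - l * b))\<^sup>2"
      by (rule sum_squares_le_square_sum[OF fin q])
    finally show "(\<Sum>l\<in>?L. if l * b \<le> r then (q (r - l * b))\<^sup>2 else 0)
        \<le> (\<Sum>l | l * b \<le> r. q (r - l * b))\<^sup>2" .
  qed
  finally show ?thesis .
qed

lemma half_le_ln_2: "1 / 2 \<le> ln (2 :: real)"
  using ln_one_minus_pos_upper_bound[of "1/2 :: real"] by (simp add: ln_div)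

text \<open>Turns the single square root produced by \<open>averaging_error_le\<close> into a
  constant times the sum of two roots.\<close>

lemma sqrt_add_le_scaled:
  assumes "x \<le> sqrt (c * (a + b))" "0 \<le> a" "0 \<le> b" "0 \<le> c"
  shows "x \<le> sqrt c * (sqrt a + sqrt b)"
proof -
  have "sqrt (a + b) \<le> sqrt a + sqrt b" using assms by (intro sqrt_add_le_add_sqrt) auto
  then have "sqrt c * sqrt (a + b) \<le> sqrt c * (sqrt a + sqrt b)"
    using assms by (intro mult_left_mono) auto
  with assms(1) show ?thesis by (simp add: real_sqrt_mult)
qed

lemma ones_inverse_eq:
  assumes "f * V = ones" "fps_nth f 0 = 1"
  shows "ones * inverse f = (V :: real fps)"
  using inverse_mult_eq_1[of f] assms(2) by (simp flip: assms(1) add: mult.commute mult.left_commute)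

section \<open>Explicit two-sided and upper bounds for the individual factorizations\<close>

lemma prefix_sqrt_error_le:
  assumes kn: "1 \<le> k" "k \<le> n" and d: "1 \<le> d" and t: "1 \<le> t" "t \<le> n"
  shows "averaging_error n k d t (prefix_sqrt n) \<le> sqrt (40 * (real k * (ln (real n) + real k) / real t))"
proof -
  let ?f = "Abs_fps sqrt_coeff"
  note b = separation_bounds[OF kn]
  have "averaging_error n k d t (toep n ?f)
      \<le> sqrt (2 * 4 * (5 * (ln (real n) + real k)) * real k / real t)"
  proof (rule averaging_error_le[OF kn d t])
    show "antimono (fps_nth ?f)" using sqrt_coeff_antimono by simp
    show "(fps_nth (ones * inverse ?f) j)\<^sup>2 \<le> 1 / real (j + 1)" for j
      using sqrt_coeff_upper[of j] by (simp add: ones_inverse_eq[OF sqrt_coeff_square])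
    show "2 * (\<Sum>j<t. 1 / real (j + 1) / real (j + 1)) \<le> 4"
      using sum_inverse_squares_le[of t] by (simp add: power2_eq_square)
    have "(\<Sum>m<n. (fps_nth ?f m)\<^sup>2) \<le> (\<Sum>m<n. 1 / real (m + 1))"
      using sqrt_coeff_upper by (intro sum_mono) auto
    also have "\<dots> \<le> 1 + ln (real n)" unfolding harm_sum using kn by (intro harm_le) auto
    finally show "(\<Sum>m<n. (fps_nth ?f m)\<^sup>2) \<le> 1 + ln (real n)" .
    have "(\<Sum>m<n. fps_nth ?f m) \<le> 1 / (1 / (2 * sqrt (real n)))"
    proof (rule convolution_ones_sum_le[OF sqrt_coeff_square])
      fix m assume m: "m < n"
      have "1 / (2 * sqrt (real n)) \<le> 1 / (2 * sqrt (real (m + 1)))"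
        using m by (intro divide_left_mono) auto
      also note sqrt_coeff_ge[of m]
      finally show "1 / (2 * sqrt (real n)) \<le> fps_nth ?f m" by simp
    qed (use kn in \<open>auto intro: less_imp_le[OF sqrt_coeff_pos]\<close>)
    then show "(\<Sum>m<n. fps_nth ?f m) \<le> 2 * sqrt (real n)" by simp
    have "real n / real (separation n k) \<le> real k"
      using b(1,4) by (simp add: divide_le_eq mult.commute flip: of_nat_mult)
    then have "(2 * sqrt (real n))\<^sup>2 / real (separation n k) \<le> 4 * real k"
      by (simp add: power_mult_distrib)
    moreover have "0 \<le> ln (real n)" "1 \<le> real k" using kn by auto
    ultimately show "1 + ln (real n) + (2 * sqrt (real n))\<^sup>2 / real (separation n k)
        \<le> 5 * (ln (real n) + real k)" unfolding distrib_left by linarith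
  qed (auto intro: less_imp_le[OF sqrt_coeff_pos])
  then show ?thesis by (simp add: prefix_sqrt_toep mult_ac)
qed

lemma prefix_sqrt_error_ge:
  assumes kn: "1 \<le> k" "k \<le> n" and d: "1 \<le> d" and t: "1 \<le> t" "t \<le> n"
  shows "sqrt (1 / 64 * (real k * (ln (real n) + real k) / real t)) \<le> averaging_error n k d t (prefix_sqrt n)"
proof -
  let ?f = "Abs_fps sqrt_coeff" and ?b = "separation n k"
  let ?M = "\<Sum>r<n. (\<Sum>l | l * ?b \<le> r. sqrt_coeff (r - l * ?b))\<^sup>2"
  note b = separation_bounds[OF kn]
  have b0: "0 < real ?b" using b(1) by simp
  have k0: "0 < real k" and n0: "0 < real n" using kn by auto
  have nb: "real k / 2 \<le> real n / real ?b"
    using b(3) b0 k0 by (simp add: field_simps)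
  \<comment> \<open>Row \<open>r\<close> meets at least \<open>(r + 1) / b\<close> participations,
    each contributing at least \<open>sqrt_coeff r\<close>, so its sum is at least
    \<open>sqrt (r + 1) / (2 b)\<close>; the squares add up to order \<open>(n / b)^2\<close>, and
    \<open>n / b \<ge> k / 2\<close>.\<close>
  have "(real k)\<^sup>2 / 32 \<le> ?M"
  proof -
    have "(real k / 2)\<^sup>2 \<le> (real n / real ?b)\<^sup>2" using nb by (intro power_mono) auto
    then have "(real k)\<^sup>2 / 32 \<le> (real n)\<^sup>2 / (8 * (real ?b)\<^sup>2)" by (simp add: power_divide mult.commute)
    also have "\<dots> \<le> (\<Sum>r<n. real (r + 1)) / (4 * (real ?b)\<^sup>2)"
    proof -
      have "(\<Sum>r<n. real (r + 1)) = real n * (real n + 1) / 2"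
        by (induction n) (auto simp: field_simps)
      then have "(real n)\<^sup>2 / 2 \<le> (\<Sum>r<n. real (r + 1))" by (simp add: power2_eq_square field_simps)
      then have "(real n)\<^sup>2 / 2 / (4 * (real ?b)\<^sup>2) \<le> (\<Sum>r<n. real (r + 1)) / (4 * (real ?b)\<^sup>2)"
        by (rule divide_right_mono) simp
      then show ?thesis by simp
    qed
    also have "\<dots> = (\<Sum>r<n. real (r + 1) / (4 * (real ?b)\<^sup>2))" by (rule sum_divide_distrib)
    also have "\<dots> \<le> ?M"
    proof (rule sum_mono)
      fix r
      let ?L = "{l. l * ?b \<le> r}"
      have L: "real (r + 1) / real ?b \<le> real (card ?L)"
        using card_multiples_below(2)[OF b(1), of "Suc r"] by (simp add: less_Suc_eq_le)
      have "sqrt (real (r + 1)) / (2 * real ?b) = real (r + 1) / real ?b * (1 / (2 * sqrt (real (r + 1))))"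
        by (subst real_div_sqrt[symmetric]) simp_all
      also have "\<dots> \<le> real (card ?L) * sqrt_coeff r"
        by (intro mult_mono L sqrt_coeff_ge) auto
      also have "\<dots> = (\<Sum>l\<in>?L. sqrt_coeff r)" by simp
      also have "\<dots> \<le> (\<Sum>l\<in>?L. sqrt_coeff (r - l * ?b))"
        by (intro sum_mono antimonoD[OF sqrt_coeff_antimono]) auto
      finally have "(sqrt (real (r + 1)) / (2 * real ?b))\<^sup>2 \<le> (\<Sum>l\<in>?L. sqrt_coeff (r - l * ?b))\<^sup>2"
        by (intro power_mono) auto
      then show "real (r + 1) / (4 * (real ?b)\<^sup>2) \<le> (\<Sum>l\<in>?L. sqrt_coeff (r - l * ?b))\<^sup>2"
        by (simp add: power_divide power_mult_distrib)
    qed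
    finally show ?thesis .
  qed
  moreover have "real k * ln (real n) / 32 \<le> ?M"
  proof -
    \<comment> \<open>Half of the horizon: at least about \<open>k / 4\<close> participations start
      there, and each column keeps about \<open>n / 2\<close> rows, enough for a logarithmic sum of
      squares.\<close>
    define h where "h = (n + 1) div 2"
    have h: "h \<le> n" "real n / 2 \<le> real h" "real n \<le> 2 * real (n - h) + 1"
      using kn by (auto simp: h_def)
    have "ln (real n) / 2 = ln (sqrt (real n))" using n0 by (simp add: ln_sqrt)
    also have "\<dots> \<le> ln (real (n - h) + 1 + 1)"
    proof (subst ln_le_cancel_iff)
      have "0 \<le> (sqrt (real n) - 1)\<^sup>2" by simp
      then have "sqrt (real n) \<le> (real n + 1) / 2" by (simp add: power2_diff)
      also have "\<dots> \<le> real (n - h) + 1 + 1" using h(3) by simp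
      finally show "sqrt (real n) \<le> real (n - h) + 1 + 1" .
    qed (use n0 in auto)
    also have "\<dots> \<le> harm (Suc (n - h))"
      using ln_le_harm[of "Suc (n - h)"] by (simp add: add_ac)
    also have "harm (Suc (n - h)) = (\<Sum>m\<le>n - h. 1 / real (m + 1))"
      by (simp only: lessThan_Suc_atMost flip: harm_sum)
    finally have "ln (real n) / 8 \<le> 1 / 4 * (\<Sum>m\<le>n - h. 1 / real (m + 1))" by simp
    also have "\<dots> \<le> (\<Sum>m\<le>n - h. (sqrt_coeff m)\<^sup>2)"
      unfolding sum_distrib_left
    proof (rule sum_mono)
      fix m
      have "1 / 4 * (1 / real (m + 1)) \<le> 1 / (4 * real m + 1)" by (simp add: divide_simps)
      also note sqrt_coeff_lower[of m]
      finally show "1 / 4 * (1 / real (m + 1)) \<le> (sqrt_coeff m)\<^sup>2" .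
    qed
    finally have s: "ln (real n) / 8 \<le> (\<Sum>m\<le>n - h. (sqrt_coeff m)\<^sup>2)" .
    have "real k / 4 \<le> real h / real ?b"
    proof -
      have "real k / 4 \<le> real n / 2 / real ?b" using nb by (simp add: mult.commute)
      also have "\<dots> \<le> real h / real ?b" using h b0 by (intro divide_right_mono) auto
      finally show ?thesis .
    qed
    then have "real k / 4 * (ln (real n) / 8) \<le> real h / real ?b * (\<Sum>m\<le>n - h. (sqrt_coeff m)\<^sup>2)"
      using s kn by (intro mult_mono) auto
    also have "\<dots> \<le> ?M"
      by (rule multiples_rows_ge[OF b(1) less_imp_le[OF sqrt_coeff_pos] h(1)])
    finally show ?thesis by simp
  qed
  ultimately have M: "real k * (ln (real n) + real k) / 64 \<le> ?M"
    by (simp add: power2_eq_square algebra_simps)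
  have "sqrt (1 * (real k * (ln (real n) + real k) / 64) / real t) \<le> averaging_error n k d t (toep n ?f)"
  proof (rule averaging_error_ge[OF kn d t])
    \<comment> \<open>The first row alone contributes 1.\<close>
    show "1 \<le> (\<Sum>i<t. (\<Sum>j\<le>i. (fps_nth (ones * inverse ?f) j)\<^sup>2) / (real (i + 1))\<^sup>2)"
      using member_le_sum[of 0 "{..<t}" "\<lambda>i. (\<Sum>j\<le>i. (fps_nth (ones * inverse ?f) j)\<^sup>2) / (real (i + 1))\<^sup>2"] t
      by (simp add: ones_inverse_eq[OF sqrt_coeff_square] sum_nonneg)
  qed (use M kn in auto)
  then show ?thesis by (simp add: prefix_sqrt_toep mult_ac)
qed

lemma identity_error_le:
  assumes kn: "1 \<le> k" "k \<le> n" and d: "1 \<le> d" and t: "2 \<le> t" "t \<le> n"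
  shows "averaging_error n k d t (1\<^sub>m n) \<le> sqrt (24 * (real k * ln (real t) / real t))"
proof -
  note b = separation_bounds[OF kn]
  have t1: "1 \<le> t" using t by simp
  have "averaging_error n k d t (toep n 1) \<le> sqrt (2 * (6 * ln (real t)) * 2 * real k / real t)"
  proof (rule averaging_error_le[OF kn d t1 t(2)])
    show "antimono (fps_nth (1::real fps))" by (rule antimonoI) auto
    show "(fps_nth (ones * inverse 1) j)\<^sup>2 \<le> 1" for j by simp
    have "ln 2 \<le> ln (real t)" using t by simp
    \<comment> \<open>For \<open>t \<ge> 2\<close> the additive 1 in the bound for the harmonic
      number is absorbed by the logarithm.\<close>
    then have "1 \<le> 2 * ln (real t)" using half_le_ln_2 by linarith
    then have "harm t \<le> 3 * ln (real t)" using harm_le[OF t1] by linarith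
    then show "2 * (\<Sum>j<t. 1 / real (j + 1)) \<le> 6 * ln (real t)" by (simp only: harm_sum)
    have "(\<Sum>m<n. fps_nth (1::real fps) m) = (\<Sum>m\<in>{0::nat}. 1)"
      by (rule sum.mono_neutral_cong_right) (use kn in auto)
    then show "(\<Sum>m<n. fps_nth (1::real fps) m) \<le> 1" by simp
    have "(\<Sum>m<n. (fps_nth (1::real fps) m)\<^sup>2) = (\<Sum>m\<in>{0::nat}. 1)"
      by (rule sum.mono_neutral_cong_right) (use kn in auto)
    then show "(\<Sum>m<n. (fps_nth (1::real fps) m)\<^sup>2) \<le> 1" by simp
    show "1 + 1\<^sup>2 / real (separation n k) \<le> (2::real)" using b(1) by (simp add: field_simps)
  qed auto
  then show ?thesis by (simp add: toep_one mult_ac)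
qed

lemma identity_error_ge:
  assumes kn: "1 \<le> k" "k \<le> n" and d: "1 \<le> d" and t: "2 \<le> t" "t \<le> n"
  shows "sqrt (1 / 2 * (real k * ln (real t) / real t)) \<le> averaging_error n k d t (1\<^sub>m n)"
proof -
  note b = separation_bounds[OF kn]
  let ?b = "separation n k"
  have t1: "1 \<le> t" using t by simp
  have "sqrt (ln (real t) * (real k / 2) / real t) \<le> averaging_error n k d t (toep n 1)"
  proof (rule averaging_error_ge[OF kn d t1 t(2)])
    have "ln (real t) \<le> harm t" using ln_le_harm[of t] t
      by (intro order_trans[OF _ ln_le_harm[of t]]) simp
    also have "harm t = (\<Sum>i<t. real (i + 1) / (real (i + 1))\<^sup>2)"
      by (simp add: power2_eq_square flip: harm_sum)
    finally show "ln (real t)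
        \<le> (\<Sum>i<t. (\<Sum>j\<le>i. (fps_nth (ones * inverse 1) j)\<^sup>2) / (real (i + 1))\<^sup>2)" by (simp add: add.commute)
    have "real k / 2 \<le> real n / real ?b"
      using b(1,3) kn by (simp add: field_simps)
    \<comment> \<open>Taking \<open>h = n\<close> counts every participation and keeps only the
      diagonal entry of each column.\<close>
    also have "\<dots> \<le> (\<Sum>r<n. (\<Sum>l | l * ?b \<le> r. fps_nth 1 (r - l * ?b))\<^sup>2)"
      using multiples_rows_ge[OF b(1), of "fps_nth 1" n n] by simp
    finally show "real k / 2 \<le> (\<Sum>r<n. (\<Sum>l | l * ?b \<le> r. fps_nth 1 (r - l * ?b))\<^sup>2)" .
  qed auto
  then show ?thesis by (simp add: toep_one mult_ac)
qed

lemma D_Toep_error_le: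
  assumes kn: "1 \<le> k" "k \<le> n" and d: "1 \<le> d" and t: "1 \<le> t" "t \<le> n"
  shows "averaging_error n k d t (D_Toep n)
    \<le> sqrt (288 * (real k / real t + (real k)\<^sup>2 / (real n * real t) * (ln (real k) * ln (real n))))"
proof -
  let ?f = "Abs_fps (\<lambda>m. 1 / real (m + 1))"
  note b = separation_bounds[OF kn]
  have f0: "fps_nth ?f 0 = 1" by simp
  have k1: "1 \<le> real k" and n1: "1 \<le> real n" and kn': "real k \<le> real n" using kn by auto
  define X where "X = real k * (ln (real k) * ln (real n)) / real n"
  have X0: "0 \<le> X" using k1 n1 by (simp add: X_def)
  \<comment> \<open>This trades one factor \<open>ln n\<close> for \<open>ln k\<close>. If
    \<open>k \<le> sqrt n\<close>, then \<open>k / n\<close> beats \<open>(ln n)^2\<close>, by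
    \<open>ln n \<le> 4 n^(1/4)\<close>; otherwise \<open>ln n \<le> 2 ln k\<close>.\<close>
  have X: "(ln (real n))\<^sup>2 * (real k / real n) \<le> 16 + 2 * X"
  proof (cases "real k \<le> sqrt (real n)")
    case True
    have "ln (real n) = 4 * ln (sqrt (sqrt (real n)))" using n1 by (simp add: ln_sqrt)
    also have "\<dots> \<le> 4 * sqrt (sqrt (real n))"
      using n1 by (intro mult_left_mono ln_bound) auto
    finally have "(ln (real n))\<^sup>2 \<le> (4 * sqrt (sqrt (real n)))\<^sup>2" using n1 by (intro power_mono) auto
    also have "\<dots> = 16 * sqrt (real n)" by (simp add: power_mult_distrib)
    finally have "(ln (real n))\<^sup>2 * (real k / real n) \<le> 16 * sqrt (real n) * (sqrt (real n) / real n)"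
      using True n1 by (intro mult_mono divide_right_mono) auto
    also have "\<dots> = 16 * (sqrt (real n) * sqrt (real n) / real n)"
      by (simp only: mult.assoc times_divide_eq_right)
    also have "\<dots> = 16" using n1 by simp
    finally show ?thesis using X0 by linarith
  next
    case False
    have "ln (real n) / 2 = ln (sqrt (real n))" using n1 by (simp add: ln_sqrt)
    also have "\<dots> \<le> ln (real k)" using False kn by (subst ln_le_cancel_iff) auto
    finally have "ln (real n) * ln (real n) \<le> 2 * ln (real k) * ln (real n)"
      using n1 by (intro mult_right_mono) auto
    then have "ln (real n) * ln (real n) * (real k / real n) \<le> 2 * ln (real k) * ln (real n) * (real k / real n)"
      by (rule mult_right_mono) simp
    also have "\<dots> = 2 * X" by (simp add: X_def)
    finally show ?thesis by (simp add: power2_eq_square)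
  qed
  have "averaging_error n k d t (toep n ?f) \<le> sqrt (2 * 4 * (36 * (1 + X)) * real k / real t)"
  proof (rule averaging_error_le[OF kn d t])
    show "antimono (fps_nth ?f)" by (rule antimonoI) (simp add: frac_le)
    show "(fps_nth (ones * inverse ?f) j)\<^sup>2 \<le> 1 / (harm (j + 1))\<^sup>2" for j
      using power_mono[OF log_coeff_le_harm[of j] less_imp_le[OF log_coeff_pos], of 2]
      unfolding ones_inverse_eq[OF log_coeff_inverse f0] by (simp add: power_divide)
    show "2 * (\<Sum>j<t. 1 / (harm (j + 1))\<^sup>2 / real (j + 1)) \<le> 4"
      using sum_harm_squares_le[of t] by (simp add: mult.commute)
    show "(\<Sum>m<n. (fps_nth ?f m)\<^sup>2) \<le> 2"
      using sum_inverse_squares_le[of n] by simp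
    show "(\<Sum>m<n. fps_nth ?f m) \<le> 1 + ln (real n)"
      using harm_sum[of n] harm_le[of n] kn by simp
    have "(1 + ln (real n))\<^sup>2 \<le> 2 + 2 * (ln (real n))\<^sup>2"
      using zero_le_power2[of "1 - ln (real n)"] by (simp add: power2_eq_square algebra_simps)
    moreover have "1 / real (separation n k) \<le> real k / real n"
      using b(1,4) n1 by (simp add: field_simps flip: of_nat_mult)
    ultimately have "(1 + ln (real n))\<^sup>2 * (1 / real (separation n k))
        \<le> (2 + 2 * (ln (real n))\<^sup>2) * (real k / real n)"
      by (intro mult_mono) auto
    also have "\<dots> = 2 * (real k / real n) + 2 * ((ln (real n))\<^sup>2 * (real k / real n))"
      by (simp add: algebra_simps)
    also have "\<dots> \<le> 2 * 1 + 2 * (16 + 2 * X)"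
      using kn' n1 X by (intro add_mono mult_left_mono) auto
    finally show "2 + (1 + ln (real n))\<^sup>2 / real (separation n k) \<le> 36 * (1 + X)"
      using X0 by simp
  qed auto
  also have "2 * 4 * (36 * (1 + X)) * real k / real t
      = 288 * (real k / real t + (real k)\<^sup>2 / (real n * real t) * (ln (real k) * ln (real n)))"
    by (simp add: X_def power2_eq_square algebra_simps add_divide_distrib)
  finally show ?thesis by (simp add: D_Toep_toep)
qed

text \<open>The band width \<open>p\<close> is comparable to \<open>L\<close>. Freezing
  \<open>W\<close> at \<open>p - 1\<close> makes the row factor of order \<open>ln n / L\<close>,
  while \<open>Q\<close> is of order \<open>1 + ln p\<close> and \<open>S^2 / b\<close> of order
  \<open>L * k / n\<close>.\<close>

lemma banded_prefix_sqrt_error_le: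
  assumes kn: "1 \<le> k" "k \<le> n" and d: "1 \<le> d" and t: "1 \<le> t" "t \<le> n"
    and e: "exp 1 < real n / real k"
  defines "L \<equiv> ln (real n / real k)" and "p \<equiv> nat \<lceil>log 2 (real (separation n k))\<rceil>"
  shows "averaging_error n k d t (banded_inverse p (prefix_sqrt n))
    \<le> sqrt (1984 * (real k * ln (real n) * ln L / (real t * L) + (real k)\<^sup>2 / (real n * real t) * ln (real n)))"
proof -
  let ?f = "Abs_fps sqrt_coeff" and ?b = "separation n k"
  note b = separation_bounds[OF kn]
  have k0: "0 < real k" and n0: "0 < real n" using kn by auto
  have nk0: "0 < real n / real k" using k0 n0 by simp
  have L1: "1 < L" using e nk0 ln_less_cancel_iff[of "exp 1" "real n / real k"] by (simp add: L_def)
  have kn_exp: "real k / real n = exp (- L)" using nk0 k0 n0 by (simp add: L_def exp_minus)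
  have lnn: "L \<le> ln (real n)" unfolding L_def using k0 n0 kn by (simp add: divide_le_eq mult_le_cancel_left1)
  have ln2: "1 / 2 \<le> ln (2::real)" "ln (2::real) \<le> 1"
    using half_le_ln_2 ln_le_minus_one[of 2] by auto
  have lb: "L \<le> ln (real ?b)" "ln (real ?b) \<le> ln 2 + L"
  proof -
    show "L \<le> ln (real ?b)" using b(2) nk0 by (simp add: L_def)
    have "ln (real ?b) \<le> ln (2 * (real n / real k))" using b(1,3) by simp
    also have "\<dots> = ln 2 + L" unfolding L_def using nk0 by (intro ln_mult_pos) auto
    finally show "ln (real ?b) \<le> ln 2 + L" .
  qed
  have log_ge: "L \<le> log 2 (real ?b)"
  proof -
    have "ln (real ?b) * ln 2 \<le> ln (real ?b)" using ln2 lb L1 by (simp add: mult_left_le)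
    then have "ln (real ?b) \<le> log 2 (real ?b)" by (simp add: log_def le_divide_eq)
    then show ?thesis using lb by linarith
  qed
  have log_le: "log 2 (real ?b) \<le> 1 + 2 * L"
  proof -
    have "L * 1 \<le> L * (2 * ln 2)" using ln2 L1 by (intro mult_left_mono) auto
    then have "ln (real ?b) \<le> (1 + 2 * L) * ln 2" using lb(2) by (simp add: algebra_simps)
    then show ?thesis by (simp add: log_def divide_le_eq)
  qed
  have p: "L \<le> real p" "real p \<le> 4 * L" "1 \<le> p"
  proof -
    have "real p = of_int \<lceil>log 2 (real ?b)\<rceil>" using log_ge L1 by (simp add: p_def)
    then show "L \<le> real p" "real p \<le> 4 * L" using log_ge log_le L1 by linarith+
    then show "1 \<le> p" using L1 by linarith
  qed
  define q where "q = inverse (fps_cutoff p (inverse ?f))"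
  have f0: "fps_nth ?f 0 = 1" by simp
  have anti: "antimono (fps_nth ?f)" using sqrt_coeff_antimono by simp
  note q = banded_inverse_coeffs[OF f0 sqrt_coeff_square _ _ anti p(3), folded q_def, simplified,
      OF sqrt_coeff_pos sqrt_coeff_log_convex]
  have rp: "1 / sqrt_coeff (p - 1) \<le> 2 * sqrt (real p)"
  proof -
    have "1 / sqrt_coeff (p - 1) \<le> 1 / (1 / (2 * sqrt (real p)))"
      using sqrt_coeff_ge[of "p - 1"] p(3) sqrt_coeff_pos[of "p - 1"] by (intro divide_left_mono) auto
    then show ?thesis by simp
  qed
  have "averaging_error n k d t (toep n q)
      \<le> sqrt (2 * (8 * ln (real n) / L) * (124 * (ln L + L * (real k / real n))) * real k / real t)"
  proof (rule averaging_error_le[OF kn d t])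
    show "(fps_nth (ones * inverse q) j)\<^sup>2 \<le> 1 / real (j + 1) + 1 / real p" for j
    proof -
      have "(fps_nth (ones * inverse q) j)\<^sup>2 \<le> 1 / real (min j (p - 1) + 1)"
        using sqrt_coeff_upper[of "min j (p - 1)"] by (simp add: q(2))
      also have "\<dots> \<le> 1 / real (j + 1) + 1 / real p"
        using p(3) by (cases "j \<le> p - 1") auto
      finally show ?thesis .
    qed
    have "(\<Sum>j<t. (1 / real (j + 1) + 1 / real p) / real (j + 1))
        = (\<Sum>j<t. (1 / real (j + 1))\<^sup>2) + 1 / real p * (\<Sum>j<t. 1 / real (j + 1))"
      by (simp add: add_divide_distrib sum.distrib power2_eq_square sum_distrib_left)
    also have "\<dots> \<le> 2 + 1 / real p * (1 + ln (real n))"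
    proof (intro add_mono mult_left_mono sum_inverse_squares_le)
      have "harm t \<le> 1 + ln (real t)" using t by (intro harm_le) auto
      also have "ln (real t) \<le> ln (real n)" using t by simp
      finally show "(\<Sum>j<t. 1 / real (j + 1)) \<le> 1 + ln (real n)" by (simp only: harm_sum)
    qed simp
    also have "\<dots> \<le> 2 * (ln (real n) / L) + 1 / L * (2 * ln (real n))"
    proof (intro add_mono mult_mono)
      show "2 \<le> 2 * (ln (real n) / L)" using lnn L1 by (simp add: le_divide_eq)
      show "1 / real p \<le> 1 / L" using p L1 by (intro divide_left_mono) auto
    qed (use L1 lnn in auto)
    finally show "2 * (\<Sum>j<t. (1 / real (j + 1) + 1 / real p) / real (j + 1)) \<le> 8 * ln (real n) / L"
      by simp
    have "(\<Sum>m<p. (sqrt_coeff m)\<^sup>2) \<le> (\<Sum>m<p. 1 / real (m + 1))"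
      by (intro sum_mono sqrt_coeff_upper)
    also have "\<dots> \<le> 1 + ln (real p)" unfolding harm_sum by (rule harm_le[OF p(3)])
    finally show "(\<Sum>m<n. (fps_nth q m)\<^sup>2) \<le> 2 + ln (real p)"
      using q(7)[of n] less_imp_neq[OF sqrt_coeff_pos[of "p - 1"]] by simp
    show "(\<Sum>m<n. fps_nth q m) \<le> 2 * sqrt (real p)"
      using q(6)[of n] rp by simp
    have "ln (real p) \<le> ln (4 * L)" using p L1 by simp
    also have "\<dots> = ln 4 + ln L" using L1 by (simp add: ln_mult)
    also have "ln (4::real) = 2 * ln 2" using ln_realpow[of 2 2] by simp
    also have "\<dots> \<le> 2" using ln2 by simp
    finally have lnp: "ln (real p) \<le> 2 + ln L" by simp
    have "1 / real ?b \<le> real k / real n"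
      using b(1,4) n0 by (simp add: field_simps flip: of_nat_mult)
    then have "4 * real p * (1 / real ?b) \<le> 4 * (4 * L) * (real k / real n)"
      using p L1 by (intro mult_mono) auto
    then have "(2 * sqrt (real p))\<^sup>2 / real ?b \<le> 16 * (L * (real k / real n))"
      by (simp add: power_mult_distrib)
    \<comment> \<open>The additive constants cannot be absorbed by \<open>ln L\<close>, which tends
      to 0 as \<open>n / k\<close> approaches \<open>e\<close>. There the other term helps:
      \<open>L * (k / n) = L * exp (- L)\<close> is at least \<open>exp (- 3) \<ge> 1 / 27\<close>
      while \<open>L \<le> 3\<close>. Hence 124, as \<open>4 * 27 + 16\<close>.\<close>
    moreover have "1 \<le> 27 * (ln L + L * (real k / real n))"
    proof (cases "exp 1 \<le> L")
      case True
      then have "1 \<le> ln L" using L1 by (simp add: ln_ge_iff)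
      moreover have "0 \<le> L * (real k / real n)" using L1 by simp
      ultimately show ?thesis unfolding distrib_left by linarith
    next
      case False
      then have "L \<le> 3" using exp_le by linarith
      then have "exp L \<le> exp 3" by simp
      also have "exp (3::real) = exp 1 ^ 3" by (simp flip: exp_of_nat_mult)
      also have "\<dots> \<le> 3 ^ 3" by (intro power_mono exp_le) auto
      finally have "1 / 27 \<le> exp (- L)" by (simp add: exp_minus field_simps)
      also have "\<dots> \<le> L * exp (- L)" using L1 by simp
      finally have "1 / 27 \<le> L * (real k / real n)" by (simp only: kn_exp)
      moreover have "0 \<le> ln L" using L1 by simp
      ultimately show ?thesis unfolding distrib_left by linarith
    qed
    moreover have "0 \<le> ln L" "0 \<le> L * (real k / real n)" using L1 by auto
    ultimately show "2 + ln (real p) + (2 * sqrt (real p))\<^sup>2 / real ?b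
        \<le> 124 * (ln L + L * (real k / real n))" using lnp unfolding distrib_left by linarith
  qed (use q in auto)
  also have "2 * (8 * ln (real n) / L) * (124 * (ln L + L * (real k / real n))) * real k / real t
      = 1984 * (real k * ln (real n) * ln L / (real t * L) + (real k)\<^sup>2 / (real n * real t) * ln (real n))"
    using L1 t n0 by (simp add: power2_eq_square field_simps)
  finally show ?thesis
    unfolding prefix_sqrt_toep banded_inverse_toep[OF f0 p(3)] q_def .
qed

text \<open>With \<open>p = b\<close> the sensitivity factor is bounded. Frozen at a value at most
  \<open>1 / L\<close>, the sequence \<open>W\<close> adds \<open>(harm n - harm b) / L^2\<close> to
  the row factor, and this difference of harmonic numbers is at most \<open>ln k\<close>.\<close>

lemma banded_D_Toep_error_le:
  assumes kn: "1 \<le> k" "k < n" and d: "1 \<le> d" and t: "1 \<le> t" "t \<le> n"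
  shows "averaging_error n k d t (banded_inverse (separation n k) (D_Toep n))
    \<le> sqrt (176 * (real k / real t + real k * ln (real k) / (real t * (ln (real n / real k))\<^sup>2)))"
proof -
  let ?f = "Abs_fps (\<lambda>m. 1 / real (m + 1))" and ?b = "separation n k"
  define L where "L = ln (real n / real k)"
  have kn': "k \<le> n" using kn by simp
  note b = separation_bounds[OF kn(1) kn']
  have k0: "0 < real k" and n0: "0 < real n" using kn by auto
  have b0: "0 < real ?b" using b(1) by simp
  have L0: "0 < L" using kn k0 by (simp add: L_def)
  have bn: "?b \<le> n"
  proof -
    have "real n / real k \<le> real n" using kn by (simp add: divide_le_eq mult_le_cancel_left1)
    then have "\<lceil>real n / real k\<rceil> \<le> int n" by (simp add: ceiling_le_iff)
    then show ?thesis by (simp only: separation_def nat_le_iff)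
  qed
  have hb: "L \<le> harm ?b"
  proof -
    have "L \<le> ln (real ?b + 1)" unfolding L_def using b(2) k0 n0 by (subst ln_le_cancel_iff) auto
    also note ln_le_harm[of ?b]
    finally show ?thesis .
  qed
  define q where "q = inverse (fps_cutoff ?b (inverse ?f))"
  have f0: "fps_nth ?f 0 = 1" by simp
  have anti: "antimono (fps_nth (Abs_fps log_coeff))" using log_coeff_antimono by simp
  note q = banded_inverse_coeffs[OF f0 log_coeff_inverse _ _ anti b(1), folded q_def, simplified,
      OF log_coeff_pos log_coeff_log_convex]
  have vb: "1 / log_coeff (?b - 1) \<le> 4 * sqrt (real ?b)"
  proof -
    have "1 / (4 * sqrt (real ?b)) \<le> log_coeff (?b - 1)"
      using sqrt_coeff_ge[of "?b - 1"] log_coeff_ge[of "?b - 1"] b(1) by simp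
    then have "1 / log_coeff (?b - 1) \<le> 1 / (1 / (4 * sqrt (real ?b)))"
      using b0 log_coeff_pos by (intro divide_left_mono) auto
    then show ?thesis by simp
  qed
  define u where "u j = 1 / (harm (j + 1))\<^sup>2 + (if ?b \<le> j then 1 / L\<^sup>2 else 0)" for j
  have "averaging_error n k d t (toep n q)
      \<le> sqrt (2 * (4 * (1 + ln (real k) / L\<^sup>2)) * 22 * real k / real t)"
  proof (rule averaging_error_le[OF kn(1) kn' d t])
    show "(fps_nth (ones * inverse q) j)\<^sup>2 \<le> u j" for j
    proof -
      let ?i = "min j (?b - 1)"
      have "(fps_nth (ones * inverse q) j)\<^sup>2 \<le> 1 / (harm (?i + 1))\<^sup>2"
        using power_mono[OF log_coeff_le_harm[of ?i] less_imp_le[OF log_coeff_pos], of 2]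
        by (simp add: q(2) power_divide)
      also have "\<dots> \<le> u j"
      proof (cases "?b \<le> j")
        case True
        then have "?i + 1 = ?b" using b(1) by simp
        moreover have "L\<^sup>2 \<le> (harm ?b)\<^sup>2" using hb L0 by (intro power_mono) auto
        then have "1 / (harm ?b)\<^sup>2 \<le> 1 / L\<^sup>2" using L0 hb by (intro divide_left_mono) auto
        ultimately show ?thesis using True by (simp add: u_def add_increasing)
      qed (auto simp: u_def)
      finally show ?thesis .
    qed
    have "(\<Sum>j<t. u j / real (j + 1)) \<le> (\<Sum>j<n. u j / real (j + 1))"
      by (rule sum_mono2) (use t in \<open>auto simp: u_def\<close>)
    also have "\<dots> = (\<Sum>j<n. 1 / (real (j + 1) * (harm (j + 1))\<^sup>2))
        + (\<Sum>j<n. if ?b \<le> j then 1 / L\<^sup>2 * (1 / real (j + 1)) else 0)"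
      unfolding sum.distrib[symmetric]
      by (intro sum.cong refl) (auto simp: u_def add_divide_distrib mult_ac)
    also have "(\<Sum>j<n. if ?b \<le> j then 1 / L\<^sup>2 * (1 / real (j + 1)) else 0)
        = (\<Sum>j\<in>{..<n} - {..<?b}. 1 / L\<^sup>2 * (1 / real (j + 1)))"
      by (rule sum.mono_neutral_cong_right) auto
    also have "\<dots> = 1 / L\<^sup>2 * (harm n - harm ?b)"
      unfolding harm_sum[symmetric] sum_distrib_left[symmetric]
      using bn by (subst sum_diff) auto
    also have "\<dots> \<le> 1 / L\<^sup>2 * ln (real k)"
    proof (rule mult_left_mono)
      \<comment> \<open>\<open>harm m - ln m\<close> decreases, so the difference of harmonic
        numbers is at most \<open>ln n - ln b\<close>; \<open>n \<le> b * k\<close> then leaves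
        \<open>ln k\<close>.\<close>
      have "harm n - ln (real n) \<le> harm ?b - ln (real ?b)"
        using b(1) bn by (intro euler_mascheroni_sequence_decreasing) auto
      moreover have "ln (real n) \<le> ln (real ?b * real k)"
        using b(4) n0 b0 k0 by (subst ln_le_cancel_iff) (auto simp flip: of_nat_mult)
      moreover have "ln (real ?b * real k) = ln (real ?b) + ln (real k)"
        using b0 k0 by (simp add: ln_mult)
      ultimately show "harm n - harm ?b \<le> ln (real k)" by linarith
    qed simp
    finally have "(\<Sum>j<t. u j / real (j + 1)) \<le> 2 + 1 / L\<^sup>2 * ln (real k)"
      using sum_harm_squares_le[of n] by linarith
    moreover have "0 \<le> 1 / L\<^sup>2 * ln (real k)" using kn by simp
    ultimately show "2 * (\<Sum>j<t. u j / real (j + 1)) \<le> 4 * (1 + ln (real k) / L\<^sup>2)" by simp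
    have "1 / real ?b * (1 / log_coeff (?b - 1)) \<le> 1 / real ?b * (4 * sqrt (real ?b))"
      by (rule mult_left_mono[OF vb]) simp
    also have "\<dots> = 4 / sqrt (real ?b)" using b0 by (simp add: field_simps)
    also have "\<dots> \<le> 4" using b(1) by (simp add: divide_le_eq)
    \<comment> \<open>2 from the coefficients inside the band and 4 from the tail beyond it.\<close>
    finally show "(\<Sum>m<n. (fps_nth q m)\<^sup>2) \<le> 6"
      using q(7)[of n] sum_inverse_squares_le[of ?b] b(1) by (simp add: add.commute of_nat_diff)
    show "(\<Sum>m<n. fps_nth q m) \<le> 4 * sqrt (real ?b)" using q(6)[of n] vb by simp
    show "6 + (4 * sqrt (real ?b))\<^sup>2 / real ?b \<le> 22" using b0 by (simp add: power_mult_distrib)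
  qed (use q in auto)
  also have "2 * (4 * (1 + ln (real k) / L\<^sup>2)) * 22 * real k / real t
      = 176 * (real k / real t + real k * ln (real k) / (real t * L\<^sup>2))"
    by (simp add: add_divide_distrib algebra_simps)
  finally show ?thesis
    unfolding D_Toep_toep banded_inverse_toep[OF f0 b(1)] q_def L_def .
qed

section \<open>From explicit constants to uniform asymptotic classes\<close>

lemma bigo_principalI:
  fixes f g :: "'a \<Rightarrow> 'b \<Rightarrow> 'c \<Rightarrow> 'd \<Rightarrow> real"
  assumes "0 < c" "\<And>n k d t. (n, k, d, t) \<in> S \<Longrightarrow> 0 \<le> f n k d t \<and> f n k d t \<le> c * g n k d t"
  shows "(\<lambda>(n, k, d, t). f n k d t) \<in> O[principal S](\<lambda>(n, k, d, t). g n k d t)"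
  unfolding bigo_principal_iff
proof (intro exI[of _ c] conjI ballI assms(1))
  fix x assume x: "x \<in> S"
  obtain n k d t where eq: "x = (n, k, d, t)" by (cases x)
  have "c * g n k d t \<le> c * \<bar>g n k d t\<bar>" using assms(1) by (intro mult_left_mono) auto
  then show "norm (case x of (n, k, d, t) \<Rightarrow> f n k d t) \<le> c * norm (case x of (n, k, d, t) \<Rightarrow> g n k d t)"
    using assms(2)[of n k d t] x by (simp add: eq)
qed

lemma bigtheta_principal_sqrtI:
  fixes f h :: "'a \<Rightarrow> 'b \<Rightarrow> 'c \<Rightarrow> 'd \<Rightarrow> real"
  assumes c: "0 < c1" "0 < c2"
    and h: "\<And>n k d t. (n, k, d, t) \<in> S \<Longrightarrow> 0 \<le> h n k d t"
    and lower: "\<And>n k d t. (n, k, d, t) \<in> S \<Longrightarrow> sqrt (c1 * h n k d t) \<le> f n k d t"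
    and upper: "\<And>n k d t. (n, k, d, t) \<in> S \<Longrightarrow> f n k d t \<le> sqrt (c2 * h n k d t)"
  shows "(\<lambda>(n, k, d, t). f n k d t) \<in> \<Theta>[principal S](\<lambda>(n, k, d, t). sqrt (h n k d t))"
proof (rule bigthetaI)
  have nonneg: "0 \<le> f n k d t" if "(n, k, d, t) \<in> S" for n k d t
    using order_trans[OF real_sqrt_ge_zero lower[OF that]] h[OF that] c by simp
  show "(\<lambda>(n, k, d, t). f n k d t) \<in> O[principal S](\<lambda>(n, k, d, t). sqrt (h n k d t))"
    using c upper nonneg by (intro bigo_principalI[of "sqrt c2"]) (auto simp: real_sqrt_mult)
  have "sqrt (h n k d t) \<le> 1 / sqrt c1 * f n k d t" if "(n, k, d, t) \<in> S" for n k d t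
    using lower[OF that] c by (simp add: real_sqrt_mult field_simps)
  then show "(\<lambda>(n, k, d, t). f n k d t) \<in> \<Omega>[principal S](\<lambda>(n, k, d, t). sqrt (h n k d t))"
    unfolding bigomega_iff_bigo using c h by (intro bigo_principalI[of "1 / sqrt c1"]) auto
qed

lemma banded_inverse_identity:
  assumes "1 \<le> k" "k \<le> n"
  shows "banded_inverse (separation n k) (1\<^sub>m n) = 1\<^sub>m n"
  using banded_inverse_toep[of 1 "separation n k" n] separation_bounds(1)[OF assms]
  by (simp add: fps_cutoff_one toep_one)

theorem theorem2:
  shows "(\<lambda>(n, k, d, t). averaging_error n k d t (prefix_sqrt n))
      \<in> \<Theta>[principal params](\<lambda>(n, k, d, t). sqrt (real k * (ln (real n) + real k) / real t))
    \<and> (\<lambda>(n, k, d, t). averaging_error n k d t (1\<^sub>m n))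
      \<in> \<Theta>[principal {(n, k, d, t) \<in> params. 2 \<le> t}](\<lambda>(n, k, d, t). sqrt (real k * ln (real t) / real t))
    \<and> (\<lambda>(n, k, d, t). averaging_error n k d t (D_Toep n))
      \<in> O[principal params](\<lambda>(n, k, d, t). sqrt (real k / real t)
          + real k / sqrt (real n * real t) * sqrt (ln (real k) * ln (real n)))
    \<and> (\<lambda>(n, k, d, t). averaging_error n k d t
          (banded_inverse (nat \<lceil>log 2 (real (separation n k))\<rceil>) (prefix_sqrt n)))
      \<in> O[principal {(n, k, d, t) \<in> params. real n / real k > exp 1}](\<lambda>(n, k, d, t).
          sqrt (real k * ln (real n) * ln (ln (real n / real k))
            / (real t * ln (real n / real k)))
          + real k / sqrt (real n * real t) * sqrt (ln (real n)))
    \<and> (\<forall>n k. 1 \<le> k \<and> k \<le> n \<longrightarrow> banded_inverse (separation n k) (1\<^sub>m n) = 1\<^sub>m n)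
    \<and> (\<lambda>(n, k, d, t). averaging_error n k d t (banded_inverse (separation n k) (1\<^sub>m n)))
      \<in> \<Theta>[principal {(n, k, d, t) \<in> params. 2 \<le> t}](\<lambda>(n, k, d, t). sqrt (real k * ln (real t) / real t))
    \<and> (\<lambda>(n, k, d, t). averaging_error n k d t (banded_inverse (separation n k) (D_Toep n)))
      \<in> O[principal {(n, k, d, t) \<in> params. k < n}](\<lambda>(n, k, d, t). sqrt (real k / real t)
          + sqrt (real k * ln (real k) / (real t * (ln (real n / real k))\<^sup>2)))"
proof (intro conjI)
  show "(\<lambda>(n, k, d, t). averaging_error n k d t (prefix_sqrt n))
      \<in> \<Theta>[principal params](\<lambda>(n, k, d, t). sqrt (real k * (ln (real n) + real k) / real t))"
    by (rule bigtheta_principal_sqrtI[of "1 / 64" 40])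
      (use prefix_sqrt_error_le prefix_sqrt_error_ge in \<open>auto simp: params_def\<close>)
  show "(\<lambda>(n, k, d, t). averaging_error n k d t (1\<^sub>m n))
      \<in> \<Theta>[principal {(n, k, d, t) \<in> params. 2 \<le> t}](\<lambda>(n, k, d, t). sqrt (real k * ln (real t) / real t))"
    by (rule bigtheta_principal_sqrtI[of "1 / 2" 24])
      (use identity_error_le identity_error_ge in \<open>auto simp: params_def\<close>)
  show "(\<lambda>(n, k, d, t). averaging_error n k d t (banded_inverse (separation n k) (1\<^sub>m n)))
      \<in> \<Theta>[principal {(n, k, d, t) \<in> params. 2 \<le> t}](\<lambda>(n, k, d, t). sqrt (real k * ln (real t) / real t))"
    by (rule bigtheta_principal_sqrtI[of "1 / 2" 24])
      (use identity_error_le identity_error_ge in \<open>auto simp: params_def banded_inverse_identity\<close>)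
  show "\<forall>n k. 1 \<le> k \<and> k \<le> n \<longrightarrow> banded_inverse (separation n k) (1\<^sub>m n) = 1\<^sub>m n"
    using banded_inverse_identity by blast
  have sq: "sqrt ((real k)\<^sup>2 / (real n * real t) * x) = real k / sqrt (real n * real t) * sqrt x" for k n t x
    by (simp add: real_sqrt_mult real_sqrt_divide)
  show "(\<lambda>(n, k, d, t). averaging_error n k d t (D_Toep n))
      \<in> O[principal params](\<lambda>(n, k, d, t). sqrt (real k / real t)
          + real k / sqrt (real n * real t) * sqrt (ln (real k) * ln (real n)))"
  proof (rule bigo_principalI[of "sqrt 288"])
    fix n k d t assume "(n, k, d, t) \<in> params"
    then have p: "1 \<le> k" "k \<le> n" "1 \<le> d" "1 \<le> t" "t \<le> n" by (auto simp: params_def)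
    have "0 \<le> averaging_error n k d t (D_Toep n)"
      unfolding D_Toep_toep using p by (intro averaging_error_nonneg) auto
    moreover have "averaging_error n k d t (D_Toep n) \<le> sqrt 288 * (sqrt (real k / real t)
        + sqrt ((real k)\<^sup>2 / (real n * real t) * (ln (real k) * ln (real n))))"
      using p by (intro sqrt_add_le_scaled[OF D_Toep_error_le]) auto
    ultimately show "0 \<le> averaging_error n k d t (D_Toep n) \<and> averaging_error n k d t (D_Toep n)
        \<le> sqrt 288 * (sqrt (real k / real t)
          + real k / sqrt (real n * real t) * sqrt (ln (real k) * ln (real n)))"
      unfolding sq by blast
  qed simp
  show "(\<lambda>(n, k, d, t). averaging_error n k d t
          (banded_inverse (nat \<lceil>log 2 (real (separation n k))\<rceil>) (prefix_sqrt n)))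
      \<in> O[principal {(n, k, d, t) \<in> params. real n / real k > exp 1}](\<lambda>(n, k, d, t).
          sqrt (real k * ln (real n) * ln (ln (real n / real k))
            / (real t * ln (real n / real k)))
          + real k / sqrt (real n * real t) * sqrt (ln (real n)))"
  proof (rule bigo_principalI[of "sqrt 1984"])
    fix n k d t assume "(n, k, d, t) \<in> {(n, k, d, t) \<in> params. real n / real k > exp 1}"
    then have p: "1 \<le> k" "k \<le> n" "1 \<le> d" "1 \<le> t" "t \<le> n" and e: "exp 1 < real n / real k"
      by (auto simp: params_def)
    let ?C = "banded_inverse (nat \<lceil>log 2 (real (separation n k))\<rceil>) (prefix_sqrt n)"
    have L: "1 < ln (real n / real k)"
      using e p ln_less_cancel_iff[of "exp 1" "real n / real k"] by simp
    \<comment> \<open>For \<open>b = 1\<close> the band width would be 0 and the truncated inverse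
      the zero matrix; \<open>n / k > e\<close> excludes this.\<close>
    have "1 < separation n k"
    proof -
      have "1 < real n / real k" using e by (smt (verit) one_less_exp_iff)
      then show ?thesis using separation_bounds(2)[OF p(1,2)] by linarith
    qed
    then have lg: "0 < log 2 (real (separation n k))" by simp
    then have b: "1 \<le> nat \<lceil>log 2 (real (separation n k))\<rceil>" by linarith
    have f0: "fps_nth (Abs_fps sqrt_coeff) 0 = 1" by simp
    have "0 \<le> averaging_error n k d t ?C"
      unfolding prefix_sqrt_toep banded_inverse_toep[OF f0 b] using p lg
      by (intro averaging_error_nonneg) auto
    moreover have "averaging_error n k d t ?C \<le> sqrt 1984 *
        (sqrt (real k * ln (real n) * ln (ln (real n / real k)) / (real t * ln (real n / real k)))
          + sqrt ((real k)\<^sup>2 / (real n * real t) * ln (real n)))"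
      using p e L by (intro sqrt_add_le_scaled[OF banded_prefix_sqrt_error_le]) auto
    ultimately show "0 \<le> averaging_error n k d t ?C \<and> averaging_error n k d t ?C \<le> sqrt 1984 *
        (sqrt (real k * ln (real n) * ln (ln (real n / real k)) / (real t * ln (real n / real k)))
          + real k / sqrt (real n * real t) * sqrt (ln (real n)))"
      unfolding sq by blast
  qed simp
  show "(\<lambda>(n, k, d, t). averaging_error n k d t (banded_inverse (separation n k) (D_Toep n)))
      \<in> O[principal {(n, k, d, t) \<in> params. k < n}](\<lambda>(n, k, d, t). sqrt (real k / real t)
          + sqrt (real k * ln (real k) / (real t * (ln (real n / real k))\<^sup>2)))"
  proof (rule bigo_principalI[of "sqrt 176"])
    fix n k d t assume "(n, k, d, t) \<in> {(n, k, d, t) \<in> params. k < n}"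
    then have p: "1 \<le> k" "k < n" "k \<le> n" "1 \<le> d" "1 \<le> t" "t \<le> n" by (auto simp: params_def)
    let ?C = "banded_inverse (separation n k) (D_Toep n)"
    note b = separation_bounds(1)[OF p(1,3)]
    have f0: "fps_nth (Abs_fps (\<lambda>m. 1 / real (m + 1))) 0 = 1" by simp
    have "0 \<le> averaging_error n k d t ?C"
      unfolding D_Toep_toep banded_inverse_toep[OF f0 b] using p b
      by (intro averaging_error_nonneg) auto
    moreover have "averaging_error n k d t ?C \<le> sqrt 176 * (sqrt (real k / real t)
        + sqrt (real k * ln (real k) / (real t * (ln (real n / real k))\<^sup>2)))"
      using p by (intro sqrt_add_le_scaled[OF banded_D_Toep_error_le]) auto
    ultimately show "0 \<le> averaging_error n k d t ?C \<and> averaging_error n k d t ?C \<le> sqrt 176 *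
        (sqrt (real k / real t) + sqrt (real k * ln (real k) / (real t * (ln (real n / real k))\<^sup>2)))"
      by blast
  qed simp
qed

end
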